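(* Let $n\ge 1$ be an integer and let $\xi(x)$, $x\in\mathbb{R}^n$, be a real-valued mean-square continuous homogeneous isotropic random field with mean zero and unit variance. Let $B(r)$, $r\ge 0$, be its covariance function (as a function of distance $r$), so that $B(0)=1$, and let $G(\lambda)$, $\lambda\ge 0$, be its spectral distribution function. Let $L(\cdot)\in\mathcal{L}$, and suppose that the function $r\mapsto r^{\frac{n-3}{2}}B(r)$ is ultimately decreasing to zero at infinity, that is, it tends to zero as $r\to\infty$ and is decreasing for $r$ larger than some number $N$. Then for $\frac{n-3}{2}<\alpha<n$ the following two statements are equivalent: (a) $r^{\alpha}B(r)\sim L(r)$ as $r\to\infty$; (b) $G(\lambda)/\lambda^{\alpha}\sim L\left(\frac{1}{\lambda}\right)/c_1(n,\alpha)$ as $\lambda\to 0+$, where $$c_1(n,\alpha):=\frac{2^{\alpha}\,\Gamma\left(\frac{\alpha}{2}+1\right)\Gamma\left(\frac{n}{2}\right)}{\Gamma\left(\frac{n-\alpha}{2}\right)}.$$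
   Context: A real-valued random field $\xi(x)$, $x\in\mathbb{R}^n$, with $\mathrm{E}\,\xi^2(x)<\infty$ is called homogeneous and isotropic (in the wide sense) if its mean $\mathrm{E}\,\xi(x)$ is constant and its covariance function $\mathrm{Cov}(\xi(x),\xi(y))$ depends only on the Euclidean distance $\|x-y\|$; one writes $\mathrm{Cov}(\xi(x),\xi(y))=B(\|x-y\|)$. If the field is mean-square continuous, there is a finite measure $F$ on $(\mathbb{R}^n,\mathcal{B}(\mathbb{R}^n))$ (the spectral measure) with $B(\|x\|)=\int_{\mathbb{R}^n}e^{i\langle x,u\rangle}F(du)$, $x\in\mathbb{R}^n$. The spectral distribution function is the bounded non-decreasing function $G(\lambda)=\int_{\{u:\,\|u\|<\lambda\}}F(du)$, $\lambda\ge 0$. Equivalently, $B(r)=\int_0^\infty Y_n(\lambda r)\,G(d\lambda)$, where $Y_1(z)=\cos z$ and, for $n\ge 2$, $Y_n(z)=2^{(n-2)/2}\Gamma\left(\frac n2\right)J_{(n-2)/2}(z)\,z^{(2-n)/2}$, $z\ge 0$, with $J_\nu$ the Bessel function of the first kind of order $\nu$. A measurable function $L:(0,\infty)\to(0,\infty)$ is slowly varying at infinity if $\lim_{\lambda\to\infty}L(\lambda t)/L(\lambda)=1$ for all $t>0$. $\mathcal{L}$ denotes the class of functions that are slowly varying at infinity and bounded on each finite interval. The notation $f\sim g$ means that the ratio $f/g$ tends to $1$ in the indicated limit. *)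

theory Defs
  imports "HOL-Probability.Probability"
begin

definition covariance :: "'w measure \<Rightarrow> ('w \<Rightarrow> real) \<Rightarrow> ('w \<Rightarrow> real) \<Rightarrow> real" where
  "covariance M X Y =
     (\<integral>w. (X w - (\<integral>v. X v \<partial>M)) * (Y w - (\<integral>v. Y v \<partial>M)) \<partial>M)"

definition second_order_field :: "'w measure \<Rightarrow> ('a \<Rightarrow> 'w \<Rightarrow> real) \<Rightarrow> bool" where
  "second_order_field M \<xi> \<longleftrightarrow>
     prob_space M \<and>
     (\<forall>x. \<xi> x \<in> borel_measurable M \<and> integrable M (\<lambda>w. (\<xi> x w)\<^sup>2))"

definition homogeneous_isotropic_field ::
    "'w measure \<Rightarrow> (real^'n \<Rightarrow> 'w \<Rightarrow> real) \<Rightarrow> (real \<Rightarrow> real) \<Rightarrow> bool" where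
  \<comment> \<open>Homogeneity and isotropy are in the wide sense. The predicate also names the covariance
      function \<open>B\<close>, whose values on negative arguments are left unspecified.\<close>
  "homogeneous_isotropic_field M \<xi> B \<longleftrightarrow>
     second_order_field M \<xi> \<and>
     (\<exists>m. \<forall>x. (\<integral>w. \<xi> x w \<partial>M) = m) \<and>
     (\<forall>x y. covariance M (\<xi> x) (\<xi> y) = B (norm (x - y)))"

definition mean_square_continuous ::
    "'w measure \<Rightarrow> ('a::topological_space \<Rightarrow> 'w \<Rightarrow> real) \<Rightarrow> bool" where
  "mean_square_continuous M \<xi> \<longleftrightarrow>
     (\<forall>x. ((\<lambda>y. \<integral>w. (\<xi> y w - \<xi> x w)\<^sup>2 \<partial>M) \<longlongrightarrow> 0) (at x))"

definition is_spectral_measure :: "(real \<Rightarrow> real) \<Rightarrow> (real^'n) measure \<Rightarrow> bool" where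
  "is_spectral_measure B F \<longleftrightarrow>
     finite_measure F \<and> sets F = sets borel \<and>
     (\<forall>x. complex_of_real (B (norm x)) = (\<integral>u. iexp (x \<bullet> u) \<partial>F))"

definition spectral_distribution_function :: "(real^'n) measure \<Rightarrow> real \<Rightarrow> real" where
  "spectral_distribution_function F l = measure F {u. norm u < l}"

text \<open>A function on \<open>(0,\<infinity>)\<close> is represented by a total function on the reals whose values outside
  \<open>(0,\<infinity>)\<close> are irrelevant.\<close>

definition slowly_varying :: "(real \<Rightarrow> real) \<Rightarrow> bool" where
  "slowly_varying L \<longleftrightarrow>
     L \<in> borel_measurable (restrict_space borel {0<..}) \<and>
     (\<forall>x>0. L x > 0) \<and>
     (\<forall>t>0. ((\<lambda>x. L (x * t) / L x) \<longlongrightarrow> 1) at_top)"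

text \<open>The finite intervals considered include those with left end point \<open>0\<close>.\<close>

definition class_L :: "(real \<Rightarrow> real) set" where
  "class_L = {L. slowly_varying L \<and> (\<forall>b>0. bounded (L ` {0<..b}))}"

definition ultimately_decreasing_to_zero :: "(real \<Rightarrow> real) \<Rightarrow> bool" where
  "ultimately_decreasing_to_zero f \<longleftrightarrow>
     (f \<longlongrightarrow> 0) at_top \<and> (\<exists>N. antimono_on {N<..} f)"

definition c1 :: "nat \<Rightarrow> real \<Rightarrow> real" where
  "c1 n \<alpha> = 2 powr \<alpha> * Gamma (\<alpha> / 2 + 1) * Gamma (real n / 2) / Gamma ((real n - \<alpha>) / 2)"

end

theory Submission
  imports Defs
begin

text \<open>Write \<open>n\<close> for the dimension and \<open>a r = r powr (- \<alpha>) * L r\<close>, a regularly varying function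
  of index \<open>- \<alpha>\<close>. The two conditions say that \<open>B r / a r\<close> tends to \<open>1\<close> and that the spectral
  mass of the ball of radius \<open>1 / r\<close>, divided by \<open>a r\<close>, tends to the reciprocal of \<open>c1 n \<alpha>\<close>,
  both as \<open>r \<rightarrow> \<infinity>\<close>. If \<open>\<alpha> < 0\<close>, both are false, because \<open>B\<close> and the spectral distribution
  function are bounded (\<open>regularly_varying_unbounded\<close>).

  Let \<open>\<alpha> \<ge> 0\<close>. The function \<open>B \<circ> norm\<close> is the Fourier transform of the spectral measure \<open>F\<close>.
  Integrating it against a Gaussian over the whole space and using that the Fourier transform of
  a Gaussian is a Gaussian, one finds in polar coordinates, with the squared radius \<open>v\<close> as
  variable, that the integral of \<open>exp (- (s * v)) * v powr (n / 2 - 1) * B (r * sqrt v)\<close> over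
  \<open>(0, \<infinity>)\<close> equals \<open>s powr (- (n / 2)) * Gamma (n / 2)\<close> times the integral of
  \<open>exp (- (r\<^sup>2 * (norm u)\<^sup>2 / (4 * s)))\<close> with respect to \<open>F\<close> (\<open>spectral_radial_duality\<close>). This
  exact identity replaces the oscillating Bessel kernel by two Laplace transforms with
  nonnegative kernels, so that only classical Abelian and Tauberian arguments on the half-line
  are needed.

  On the spectral side, the asymptotics of the distribution function pass to its Laplace
  transform by dominated convergence (\<open>spectral_abelian\<close>), and back by Karamata's theorem
  (\<open>spectral_tauberian\<close>), which is proved with Weierstrass approximation by polynomials in
  \<open>exp (- v)\<close>. On the covariance side the forward direction is again dominated convergence
  (\<open>laplace_abelian\<close>). For the converse, \<open>B\<close> is nonnegative for large arguments, because
  \<open>r powr ((n - 3) / 2) * B r\<close> decreases to \<open>0\<close>; hence Karamata's theorem applies to \<open>B\<close> as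
  well, and monotonicity allows one to differentiate the resulting asymptotic relation
  (\<open>laplace_tauberian_monotone\<close>).

  Uniform bounds on ratios of a slowly varying function are never needed for \<open>L\<close> itself. In each
  direction \<open>a\<close> is asymptotic to a multiple of \<open>B\<close> or of the spectral distribution function, and
  for these monotonicity turns the doubling ratio into a power bound
  (\<open>regularly_varying_bound\<close>).\<close>

section \<open>The measure with distribution function a power\<close>

text \<open>For \<open>\<beta> \<ge> 0\<close>, the measure on \<open>[0, \<infinity>)\<close> that gives \<open>[0, v)\<close> the mass \<open>v powr \<beta>\<close> when \<open>v > 0\<close>.
  For \<open>\<beta> = 0\<close> this is the unit mass at \<open>0\<close>, which has no density; including it lets the index
  \<open>\<alpha> = 0\<close> be treated like the others.\<close>

definition power_measure :: "real \<Rightarrow> real measure" where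
  "power_measure \<beta> =
     (if \<beta> = 0 then return borel 0
      else density lborel (\<lambda>x. ennreal (indicator {0<..} x * (\<beta> * x powr (\<beta> - 1)))))"

lemma sets_power_measure [simp, measurable_cong]: "sets (power_measure \<beta>) = sets borel"
  by (simp add: power_measure_def)

lemma space_power_measure [simp]: "space (power_measure \<beta>) = UNIV"
  by (simp add: power_measure_def)

lemma nn_integral_exp_powr:
  fixes s b :: real
  assumes "s > 0" "b > 0"
  shows "(\<integral>\<^sup>+t. ennreal (indicator {0<..} t * (t powr (b - 1) * exp (- (s * t)))) \<partial>lborel)
           = ennreal (Gamma b * s powr (- b))"
proof -
  let ?I = "\<integral>\<^sup>+t. ennreal (indicator {0<..} t * (t powr (b - 1) * exp (- (s * t)))) \<partial>lborel"
  have "ennreal (Gamma b) =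
      (\<integral>\<^sup>+t. ennreal (indicator {0..} t * t powr (b - 1) / exp t) \<partial>lborel)"
    by (rule Gamma_conv_nn_integral_real) fact
  also have "\<dots> = s * (\<integral>\<^sup>+t. ennreal (indicator {0..} (0 + s * t) * (0 + s * t) powr (b - 1)
      / exp (0 + s * t)) \<partial>lborel)"
    using assms by (subst nn_integral_real_affine[where c = s and t = 0]) auto
  also have "(\<integral>\<^sup>+t. ennreal (indicator {0..} (0 + s * t) * (0 + s * t) powr (b - 1)
      / exp (0 + s * t)) \<partial>lborel)
    = (\<integral>\<^sup>+t. ennreal (s powr (b - 1)) * ennreal (indicator {0<..} t * (t powr (b - 1)
        * exp (- (s * t)))) \<partial>lborel)"
    using assms
    by (intro nn_integral_cong)
       (auto simp: ennreal_mult'[symmetric] indicator_def powr_mult exp_minus field_simps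
          zero_le_mult_iff)
  also have "\<dots> = ennreal (s powr (b - 1)) * ?I"
    by (subst nn_integral_cmult) auto
  finally have "ennreal (Gamma b) = ennreal (s * s powr (b - 1)) * ?I"
    using assms by (simp add: ennreal_mult mult.assoc)
  also have "s * s powr (b - 1) = s powr b"
    using assms by (simp add: powr_diff)
  finally have "ennreal (s powr (-b)) * ennreal (Gamma b)
      = ennreal (s powr (-b) * s powr b) * ?I"
    by (simp add: ennreal_mult mult.assoc)
  also have "s powr (-b) * s powr b = 1"
    using assms by (simp add: powr_add[symmetric])
  finally show ?thesis
    using assms Gamma_real_pos[of b] by (simp add: ennreal_mult' mult.commute)
qed

lemma emeasure_power_measure:
  assumes "\<beta> \<ge> 0" "v > 0"
  shows "emeasure (power_measure \<beta>) {..<v} = ennreal (v powr \<beta>)"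
proof (cases "\<beta> = 0")
  case True
  then show ?thesis using assms by (simp add: power_measure_def)
next
  case False
  then have b: "\<beta> > 0" using assms by simp
  have "emeasure (power_measure \<beta>) {..<v} =
     (\<integral>\<^sup>+x. ennreal (indicator {0<..} x * (\<beta> * x powr (\<beta> - 1))) * indicator {..<v} x \<partial>lborel)"
    using False by (simp add: power_measure_def emeasure_density)
  also have "\<dots> = (\<integral>\<^sup>+x. ennreal \<beta> * (ennreal (x powr (\<beta> - 1)) * indicator {0..v} x) \<partial>lborel)"
    using b assms
    by (intro nn_integral_cong_AE eventually_mono[OF AE_lborel_singleton[of v]])
       (auto simp: indicator_def ennreal_mult')
  also have "\<dots> = ennreal \<beta> * ennreal (v powr (\<beta> - 1 + 1) / (\<beta> - 1 + 1))"
    using b assms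
    by (subst nn_integral_cmult, simp)
       (subst nn_integral_has_integral_lebesgue'[OF _ has_integral_powr_from_0], auto)
  also have "\<dots> = ennreal (v powr \<beta>)"
    using b by (simp add: ennreal_mult'[symmetric])
  finally show ?thesis .
qed

lemma emeasure_power_measure_nonpos:
  assumes "v \<le> 0"
  shows "emeasure (power_measure \<beta>) {..<v} = 0"
proof (cases "\<beta> = 0")
  case True
  then show ?thesis using assms by (simp add: power_measure_def)
next
  case False
  have "(\<lambda>x. ennreal (indicator {0<..} x * (\<beta> * x powr (\<beta> - 1))) * indicator {..<v} x) = (\<lambda>x. 0)"
    using assms by (auto simp: indicator_def fun_eq_iff)
  then show ?thesis
    using False by (simp add: power_measure_def emeasure_density)
qed

lemma AE_power_measure_nonneg: "AE x in power_measure \<beta>. x \<ge> 0"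
proof -
  have "{x. \<not> x \<ge> 0} = {..<0::real}" by auto
  then show ?thesis
    by (subst AE_iff_null) (auto simp: null_sets_def emeasure_power_measure_nonpos pred_def)
qed

lemma has_bochner_integral_exp_power_measure:
  fixes s :: real
  assumes "\<beta> \<ge> 0" "s > 0"
  shows "has_bochner_integral (power_measure \<beta>) (\<lambda>x. exp (- (s * x)))
           (Gamma (\<beta> + 1) * s powr (- \<beta>))"
proof (rule has_bochner_integral_nn_integral)
  show "(\<integral>\<^sup>+x. ennreal (exp (- (s * x))) \<partial>power_measure \<beta>)
      = ennreal (Gamma (\<beta> + 1) * s powr (- \<beta>))"
  proof (cases "\<beta> = 0")
    case True
    then show ?thesis using assms by (simp add: power_measure_def nn_integral_return)
  next
    case False
    then have b: "\<beta> > 0" using assms by simp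
    have "(\<integral>\<^sup>+x. ennreal (exp (- (s * x))) \<partial>power_measure \<beta>)
      = (\<integral>\<^sup>+x. ennreal (indicator {0<..} x * (\<beta> * x powr (\<beta> - 1))) * ennreal (exp (- (s * x)))
          \<partial>lborel)"
      using False by (simp add: power_measure_def nn_integral_density)
    also have "\<dots> = (\<integral>\<^sup>+x. ennreal \<beta> *
        ennreal (indicator {0<..} x * (x powr (\<beta> - 1) * exp (- (s * x)))) \<partial>lborel)"
      using b by (intro nn_integral_cong) (auto simp: indicator_def ennreal_mult'[symmetric])
    also have "\<dots> = ennreal \<beta> * ennreal (Gamma \<beta> * s powr (- \<beta>))"
      using assms b by (subst nn_integral_cmult) (auto simp: nn_integral_exp_powr)
    also have "\<dots> = ennreal (\<beta> * Gamma \<beta> * s powr (- \<beta>))"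
      using b by (simp add: ennreal_mult' mult.assoc)
    also have "\<beta> * Gamma \<beta> = Gamma (\<beta> + 1)"
      using b Gamma_plus1[of \<beta>] by (metis nonpos_Ints_nonpos not_le)
    finally show ?thesis .
  qed
qed (use assms Gamma_real_pos[of "\<beta> + 1"] in auto)

text \<open>The half-lines \<open>{..<v}\<close> generate the Borel sets and have finite mass, so they determine
  the measure.\<close>

lemma power_measure_eqI:
  assumes sets: "sets M = sets borel" and b: "\<beta> \<ge> 0"
    and pos: "\<And>v. v > 0 \<Longrightarrow> emeasure M {..<v} = ennreal (v powr \<beta>)"
    and nonpos: "\<And>v. v \<le> 0 \<Longrightarrow> emeasure M {..<v} = 0"
  shows "M = power_measure \<beta>"
proof (rule measure_eqI_generator_eq[where E = "range lessThan" and \<Omega> = UNIV and A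
    = "\<lambda>n. {..<real n}"])
  show "Int_stable (range lessThan :: real set set)"
    by (auto simp: Int_stable_def intro: image_eqI[of _ lessThan "min _ _"])
  show "emeasure M X = emeasure (power_measure \<beta>) X" if "X \<in> range lessThan" for X
  proof -
    from that obtain v where "X = {..<v}" by auto
    then show ?thesis
      using pos[of v] nonpos[of v] emeasure_power_measure[OF b, of v]
        emeasure_power_measure_nonpos[of v]
      by (cases "v > 0") auto
  qed
  have "sets (borel :: real measure) = sigma_sets UNIV (range lessThan)"
    by (subst borel_Iio) (simp add: sets_measure_of)
  then show "sets M = sigma_sets UNIV (range lessThan)"
    and "sets (power_measure \<beta>) = sigma_sets UNIV (range lessThan)"
    using sets by auto
  show "(\<Union>i. {..<real i}) = UNIV"
    using reals_Archimedean2 by auto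
  show "emeasure M {..<real i} \<noteq> \<infinity>" for i
    using pos[of "real i"] nonpos[of "real i"] by (cases "real i > 0") auto
qed auto

section \<open>Karamata's Tauberian theorem\<close>

lemma integrable_continuous_unit_mult:
  fixes h :: "real \<Rightarrow> real"
  assumes h: "continuous_on UNIV h"
    and X [measurable]: "X \<in> borel_measurable M" and X01: "AE x in M. X x \<in> {0..1}"
    and g: "integrable M g"
  shows "integrable M (\<lambda>x. h (X x) * g x)"
proof -
  have "bounded (h ` {0..1})"
    by (intro compact_imp_bounded compact_continuous_image continuous_on_subset[OF h]) auto
  then obtain K where K: "\<And>y. y \<in> {0..1} \<Longrightarrow> \<bar>h y\<bar> \<le> K"
    by (force simp: bounded_iff)
  have [measurable]: "h \<in> borel_measurable borel"
    by (rule borel_measurable_continuous_onI[OF h])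
  have [measurable]: "g \<in> borel_measurable M" using g by auto
  show ?thesis
  proof (rule Bochner_Integration.integrable_bound)
    show "integrable M (\<lambda>x. K * g x)" using g by simp
    show "AE x in M. norm (h (X x) * g x) \<le> norm (K * g x)"
      using X01
    proof eventually_elim
      case (elim x)
      have "\<bar>h (X x)\<bar> \<le> \<bar>K\<bar>" using K[OF elim] by linarith
      then show ?case by (simp add: abs_mult mult_right_mono)
    qed
  qed auto
qed

lemma integral_uniform_approx:
  fixes h p :: "real \<Rightarrow> real"
  assumes h: "continuous_on UNIV h" and p: "continuous_on UNIV p"
    and X: "X \<in> borel_measurable M" and X01: "AE x in M. X x \<in> {0..1}"
    and g: "integrable M g" and g0: "AE x in M. g x \<ge> 0"
    and e: "\<And>y. y \<in> {0..1} \<Longrightarrow> \<bar>h y - p y\<bar> \<le> e"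
  shows "\<bar>(\<integral>x. h (X x) * g x \<partial>M) - (\<integral>x. p (X x) * g x \<partial>M)\<bar> \<le> e * (\<integral>x. g x \<partial>M)"
proof -
  note [simp] = integrable_continuous_unit_mult[OF h X X01 g]
    integrable_continuous_unit_mult[OF p X X01 g] g
  have "(\<integral>x. h (X x) * g x \<partial>M) - (\<integral>x. p (X x) * g x \<partial>M)
      = (\<integral>x. h (X x) * g x - p (X x) * g x \<partial>M)" by simp
  also have "\<bar>\<dots>\<bar> \<le> (\<integral>x. e * g x \<partial>M)"
  proof -
    have "AE x in M. norm (h (X x) * g x - p (X x) * g x) \<le> e * g x"
      using X01 g0
    proof eventually_elim
      case (elim x)
      have "norm (h (X x) * g x - p (X x) * g x) = \<bar>h (X x) - p (X x)\<bar> * g x"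
        using elim by (simp add: abs_mult left_diff_distrib[symmetric])
      also have "\<dots> \<le> e * g x" by (intro mult_right_mono e elim)
      finally show ?case .
    qed
    then have "(\<integral>x. norm (h (X x) * g x - p (X x) * g x) \<partial>M) \<le> (\<integral>x. e * g x \<partial>M)"
      by (intro integral_mono_AE) simp_all
    then show ?thesis
      using integral_norm_bound[of M "\<lambda>x. h (X x) * g x - p (X x) * g x"] by simp
  qed
  finally show ?thesis by simp
qed

text \<open>A method of moments for weighted measures: by Weierstrass approximation, convergence of
  the integrals of all powers of a \<open>[0, 1]\<close>-valued function gives convergence for continuous
  functions. The approximation error is controlled because the total masses (the case \<open>k = 0\<close>)
  converge.\<close>

lemma tendsto_integral_of_moments:
  fixes h :: "real \<Rightarrow> real" and X g :: "'i \<Rightarrow> 'a \<Rightarrow> real"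
  assumes h: "continuous_on UNIV h"
    and X: "\<And>i. X i \<in> borel_measurable M" "\<And>i. AE x in M. X i x \<in> {0..1}"
    and g: "\<And>i. integrable M (g i)" "\<And>i. AE x in M. g i x \<ge> 0"
    and Y: "Y \<in> borel_measurable N" "AE x in N. Y x \<in> {0..1}"
    and f: "integrable N f" "AE x in N. f x \<ge> 0"
    and lim: "\<And>k. ((\<lambda>i. \<integral>x. X i x ^ k * g i x \<partial>M) \<longlongrightarrow> (\<integral>x. Y x ^ k * f x \<partial>N)) Fr"
  shows "((\<lambda>i. \<integral>x. h (X i x) * g i x \<partial>M) \<longlongrightarrow> (\<integral>x. h (Y x) * f x \<partial>N)) Fr"
proof (rule tendstoI)
  fix e :: real assume e: "e > 0"
  define A where "A = (\<integral>x. f x \<partial>N)"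
  have A: "A \<ge> 0" unfolding A_def using f by (intro integral_nonneg_AE)
  define d where "d = e / (2 * A + 2)"
  have d: "d > 0" using e A by (simp add: d_def)
  obtain p where "real_polynomial_function p" and p: "\<And>y. y \<in> {0..1} \<Longrightarrow> \<bar>h y - p y\<bar> < d"
    using Stone_Weierstrass_real_polynomial_function[of "{0..1}" h d] d continuous_on_subset[OF h]
    by (metis compact_Icc top_greatest)
  then obtain a n where pa: "p = (\<lambda>y. \<Sum>k\<le>n. a k * y ^ k)"
    by (auto simp: real_polynomial_function_iff_sum)
  have pc: "continuous_on UNIV p" unfolding pa by (intro continuous_intros)
  have pow: "continuous_on UNIV (\<lambda>y::real. y ^ k)" for k by (intro continuous_intros)
  have sum1: "(\<integral>x. p (X i x) * g i x \<partial>M) = (\<Sum>k\<le>n. a k * (\<integral>x. X i x ^ k * g i x \<partial>M))" for i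
    using integrable_continuous_unit_mult[OF pow X(1,2) g(1)]
    by (simp add: pa sum_distrib_right mult.assoc)
  have sum2: "(\<integral>x. p (Y x) * f x \<partial>N) = (\<Sum>k\<le>n. a k * (\<integral>x. Y x ^ k * f x \<partial>N))"
    using integrable_continuous_unit_mult[OF pow Y f(1)]
    by (simp add: pa sum_distrib_right mult.assoc)
  have "((\<lambda>i. \<bar>(\<integral>x. p (X i x) * g i x \<partial>M) - (\<integral>x. p (Y x) * f x \<partial>N)\<bar> + d * (\<integral>x. g i x \<partial>M) + d * A)
      \<longlongrightarrow> \<bar>(\<integral>x. p (Y x) * f x \<partial>N) - (\<integral>x. p (Y x) * f x \<partial>N)\<bar> + d * A + d * A) Fr"
    unfolding sum1 sum2 A_def using lim[of 0] by (intro tendsto_intros lim) simp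
  moreover have "\<bar>(\<integral>x. p (Y x) * f x \<partial>N) - (\<integral>x. p (Y x) * f x \<partial>N)\<bar> + d * A + d * A < e"
  proof -
    have "d * (2 * A + 2) = e" using A by (simp add: d_def)
    then show ?thesis using d by (simp add: algebra_simps)
  qed
  ultimately have "\<forall>\<^sub>F i in Fr. \<bar>(\<integral>x. p (X i x) * g i x \<partial>M) - (\<integral>x. p (Y x) * f x \<partial>N)\<bar>
      + d * (\<integral>x. g i x \<partial>M) + d * A < e"
    by (rule order_tendstoD(2))
  then show "\<forall>\<^sub>F i in Fr. dist (\<integral>x. h (X i x) * g i x \<partial>M) (\<integral>x. h (Y x) * f x \<partial>N) < e"
  proof eventually_elim
    case (elim i)
    have "\<bar>(\<integral>x. h (X i x) * g i x \<partial>M) - (\<integral>x. p (X i x) * g i x \<partial>M)\<bar> \<le> d * (\<integral>x. g i x \<partial>M)"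
      by (rule integral_uniform_approx[OF h pc X g]) (use p in \<open>auto intro: less_imp_le\<close>)
    moreover have "\<bar>(\<integral>x. h (Y x) * f x \<partial>N) - (\<integral>x. p (Y x) * f x \<partial>N)\<bar> \<le> d * A"
      unfolding A_def
      by (rule integral_uniform_approx[OF h pc Y f]) (use p in \<open>auto intro: less_imp_le\<close>)
    ultimately show ?case using elim unfolding dist_real_def by linarith
  qed
qed

text \<open>The continuous piecewise linear function that is \<open>1\<close> up to \<open>a\<close> and \<open>0\<close> from \<open>b\<close> on (for
  \<open>a < b\<close>).\<close>

definition cutoff :: "real \<Rightarrow> real \<Rightarrow> real \<Rightarrow> real" where
  "cutoff a b t = max 0 (min 1 ((b - t) / (b - a)))"

lemma cutoff_bounds:
  assumes "a < b"
  shows "indicator {..<a} t \<le> cutoff a b t" "cutoff a b t \<le> indicator {..<b} t"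
  using assms by (auto simp: cutoff_def indicator_def field_simps)

text \<open>Since the cutoff vanishes for large \<open>t\<close>, it can be divided by \<open>exp (- t)\<close> and written as a
  continuous function of \<open>exp (- t)\<close>, including at the value \<open>0\<close>.\<close>

lemma cutoff_exp_form:
  assumes "a < b"
  obtains h where "continuous_on UNIV h" "\<And>t. h (exp (- t)) * exp (- t) = cutoff a b t"
proof
  let ?m = "\<lambda>y. max y (exp (- b))"
  let ?h = "\<lambda>y. cutoff a b (- ln (?m y)) / ?m y"
  have pos: "?m y > 0" for y by (simp add: less_max_iff_disj)
  then have ne: "?m y \<noteq> 0" for y by (metis less_irrefl)
  show "continuous_on UNIV ?h"
    unfolding cutoff_def using assms ne by (intro continuous_intros) auto
  show "?h (exp (- t)) * exp (- t) = cutoff a b t" for t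
  proof (cases "t \<le> b")
    case True
    then have "?m (exp (- t)) = exp (- t)" by simp
    then show ?thesis by simp
  next
    case False
    then have "?m (exp (- t)) = exp (- b)" by simp
    then show ?thesis using False assms
      by (simp add: cutoff_def min_def max_def field_simps)
  qed
qed

text \<open>Stated for a family of weights \<open>g i\<close> on one measure space and a nonnegative variable
  \<open>T i\<close>: if the Laplace transforms of the weighted laws of \<open>T i\<close> tend to that of \<open>C\<close> times the
  power measure, then so do the masses of \<open>{T i < v}\<close>. The weights \<open>exp (- T i) * g i\<close> have
  converging moments in \<open>exp (- T i)\<close>; the indicator of \<open>{..<v}\<close> is then squeezed between two
  cutoffs.\<close>

theorem karamata_tauberian:
  fixes T g :: "'i \<Rightarrow> 'a \<Rightarrow> real"
  assumes b: "\<beta> \<ge> 0" and C: "C \<ge> 0" and v: "v > 0"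
    and T [measurable]: "\<And>i. T i \<in> borel_measurable M" and T0: "\<And>i. AE x in M. T i x \<ge> 0"
    and g [measurable]: "\<And>i. g i \<in> borel_measurable M" and g0: "\<And>i. AE x in M. g i x \<ge> 0"
    and int: "\<And>i. integrable M (\<lambda>x. exp (- T i x) * g i x)"
    and lim: "\<And>s. s > 0 \<Longrightarrow> ((\<lambda>i. \<integral>x. exp (- (s * T i x)) * g i x \<partial>M)
                \<longlongrightarrow> C * (Gamma (\<beta> + 1) * s powr (- \<beta>))) Fr"
  shows "((\<lambda>i. \<integral>x. indicator {..<v} (T i x) * g i x \<partial>M) \<longlongrightarrow> C * v powr \<beta>) Fr"
proof -
  let ?P = "power_measure \<beta>"
  have expP: "integrable ?P (\<lambda>x. exp (- x))"
    using has_bochner_integral_exp_power_measure[OF b, of 1]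
        by (auto simp: has_bochner_integral_iff)
  have cut: "integrable M (\<lambda>x. cutoff a b (T i x) * g i x)"
    "integrable ?P (\<lambda>x. C * cutoff a b x)"
    "((\<lambda>i. \<integral>x. cutoff a b (T i x) * g i x \<partial>M) \<longlongrightarrow> (\<integral>x. C * cutoff a b x \<partial>?P)) Fr"
    if ab: "a < b" for a b i
  proof -
    obtain h where h: "continuous_on UNIV h" "\<And>t. h (exp (- t)) * exp (- t) = cutoff a b t"
      using cutoff_exp_form[OF ab] by metis
    have h': "h (exp (- t)) * (exp (- t) * z) = cutoff a b t * z"
        "h (exp (- t)) * (z * exp (- t)) = z * cutoff a b t" for t z
      unfolding h(2)[of t, symmetric] by (simp_all only: mult_ac)
    have Xm: "(\<lambda>x. exp (- T i x)) \<in> borel_measurable M" for i by simp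
    have Ym: "(\<lambda>x. exp (- x)) \<in> borel_measurable ?P" by simp
    have X: "AE x in M. exp (- T i x) \<in> {0..1}" for i
      using T0[of i] by eventually_elim auto
    have eg: "AE x in M. 0 \<le> exp (- T i x) * g i x" for i
      using g0[of i] by eventually_elim auto
    have Y: "AE x in ?P. exp (- x) \<in> {0..1}"
      using AE_power_measure_nonneg[of \<beta>] by eventually_elim auto
    have f: "integrable ?P (\<lambda>x. C * exp (- x))" "AE x in ?P. 0 \<le> C * exp (- x)"
      using expP C by auto
    show "integrable M (\<lambda>x. cutoff a b (T i x) * g i x)"
      using integrable_continuous_unit_mult[OF h(1) Xm[of i] X[of i] int[of i]] by (simp add: h')
    show "integrable ?P (\<lambda>x. C * cutoff a b x)"
      using integrable_continuous_unit_mult[OF h(1) Ym Y f(1)] by (simp add: h')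
    have "((\<lambda>i. \<integral>x. h (exp (- T i x)) * (exp (- T i x) * g i x) \<partial>M)
        \<longlongrightarrow> (\<integral>x. h (exp (- x)) * (C * exp (- x)) \<partial>?P)) Fr"
    proof (rule tendsto_integral_of_moments[OF h(1) Xm X int eg Ym Y f])
      fix k :: nat
      have e0: "exp (- (real (Suc k) * t)) = exp (- t) ^ k * exp (- t)" for t :: real
        using exp_of_nat_mult[of "Suc k" "- t"] by (simp del: of_nat_Suc)
      have e: "exp (- t) ^ k * (exp (- t) * z) = exp (- (real (Suc k) * t)) * z"
         "exp (- t) ^ k * (z * exp (- t)) = z * exp (- (real (Suc k) * t))" for t z :: real
        unfolding e0 by (simp_all only: mult_ac)
      have eq: "(\<integral>x. exp (- (real (Suc k) * x)) \<partial>?P) = Gamma (\<beta> + 1) * real (Suc k) powr (- \<beta>)"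
        using has_bochner_integral_exp_power_measure[OF b, of "real (Suc k)"]
        by (simp add: has_bochner_integral_iff del: of_nat_Suc)
      show "((\<lambda>i. \<integral>x. exp (- T i x) ^ k * (exp (- T i x) * g i x) \<partial>M)
          \<longlongrightarrow> (\<integral>x. exp (- x) ^ k * (C * exp (- x)) \<partial>?P)) Fr"
        unfolding e integral_mult_right_zero eq by (rule lim) simp
    qed
    then show "((\<lambda>i. \<integral>x. cutoff a b (T i x) * g i x \<partial>M) \<longlongrightarrow> (\<integral>x. C * cutoff a b x \<partial>?P)) Fr"
      by (simp add: h')
  qed
  have ind: "integrable ?P (\<lambda>x. C * indicator {..<w} x)"
    "(\<integral>x. C * indicator {..<w} x \<partial>?P) = C * w powr \<beta>" if "w > 0" for w
    using emeasure_power_measure[OF b that] by (auto simp: measure_def)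
  have indM: "integrable M (\<lambda>x. indicator {..<w} (T i x) * g i x)" for w i
  proof (rule Bochner_Integration.integrable_bound[OF cut(1)[of w "w + 1" i]])
    show "AE x in M. norm (indicator {..<w} (T i x) * g i x)
        \<le> norm (cutoff w (w + 1) (T i x) * g i x)"
      using g0[of i]
    proof eventually_elim
      case (elim x)
      have "norm (indicator {..<w} (T i x) * g i x) = indicator {..<w} (T i x) * g i x"
        using elim by (simp add: abs_mult)
      also have "\<dots> \<le> cutoff w (w + 1) (T i x) * g i x"
        using elim by (intro mult_right_mono cutoff_bounds) auto
      also have "\<dots> \<le> norm (cutoff w (w + 1) (T i x) * g i x)" by simp
      finally show ?case .
    qed
  qed auto
  let ?J = "\<lambda>i. \<integral>x. indicator {..<v} (T i x) * g i x \<partial>M"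
  have upper: "\<forall>\<^sub>F i in Fr. ?J i < y" if y: "C * v powr \<beta> < y" for y
  proof -
    have "((\<lambda>w. C * w powr \<beta>) \<longlongrightarrow> C * v powr \<beta>) (at_right v)"
      using v by (intro tendsto_intros) auto
    from order_tendstoD(2)[OF this y]
    have "\<forall>\<^sub>F w in at_right v. C * w powr \<beta> < y \<and> v < w"
      by (intro eventually_conj eventually_at_right_less)
    from eventually_happens'[OF trivial_limit_at_right_real this]
    obtain w where w: "C * w powr \<beta> < y" "v < w" by auto
    have "(\<integral>x. C * cutoff v w x \<partial>?P) \<le> (\<integral>x. C * indicator {..<w} x \<partial>?P)"
      using w v C cutoff_bounds[OF w(2)]
      by (intro integral_mono cut ind mult_left_mono) auto
    then have "(\<integral>x. C * cutoff v w x \<partial>?P) < y" using ind(2)[of w] w v by linarith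
    from order_tendstoD(2)[OF cut(3)[OF w(2)] this] show ?thesis
    proof eventually_elim
      case (elim i)
      have "?J i \<le> (\<integral>x. cutoff v w (T i x) * g i x \<partial>M)"
      proof (rule integral_mono_AE[OF indM cut(1)[OF w(2)]])
        show "AE x in M. indicator {..<v} (T i x) * g i x \<le> cutoff v w (T i x) * g i x"
          using g0[of i] by eventually_elim (intro mult_right_mono cutoff_bounds w)
      qed
      with elim show ?case by linarith
    qed
  qed
  have lower: "\<forall>\<^sub>F i in Fr. y < ?J i" if y: "y < C * v powr \<beta>" for y
  proof -
    have "((\<lambda>w. C * w powr \<beta>) \<longlongrightarrow> C * v powr \<beta>) (at_left v)"
      using v by (intro tendsto_intros) auto
    from order_tendstoD(1)[OF this y]
    have "\<forall>\<^sub>F w in at_left v. y < C * w powr \<beta> \<and> w \<in> {0<..<v}"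
      using v by (intro eventually_conj eventually_at_left_real) auto
    from eventually_happens'[OF trivial_limit_at_left_real this]
    obtain w where w: "y < C * w powr \<beta>" "0 < w" "w < v" by auto
    have "(\<integral>x. C * indicator {..<w} x \<partial>?P) \<le> (\<integral>x. C * cutoff w v x \<partial>?P)"
      using w v C cutoff_bounds[OF w(3)]
      by (intro integral_mono cut ind mult_left_mono) auto
    then have "y < (\<integral>x. C * cutoff w v x \<partial>?P)" using ind(2)[of w] w v by linarith
    from order_tendstoD(1)[OF cut(3)[OF w(3)] this] show ?thesis
    proof eventually_elim
      case (elim i)
      have "(\<integral>x. cutoff w v (T i x) * g i x \<partial>M) \<le> ?J i"
      proof (rule integral_mono_AE[OF cut(1)[OF w(3)] indM])
        show "AE x in M. cutoff w v (T i x) * g i x \<le> indicator {..<v} (T i x) * g i x"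
          using g0[of i] by eventually_elim (intro mult_right_mono cutoff_bounds w)
      qed
      with elim show ?case by linarith
    qed
  qed
  show ?thesis by (rule order_tendstoI) (use upper lower in auto)
qed

section \<open>Polar coordinates and the Fourier transform of the Gaussian\<close>

text \<open>The image of Lebesgue measure under the squared norm is a multiple of a power measure,
  because the ball of squared radius \<open>v\<close> has volume \<open>unit_ball_vol n * v powr (n / 2)\<close>.\<close>

lemma density_distr_norm_sq:
  fixes dummy :: "'a::euclidean_space"
  defines "n \<equiv> real DIM('a)"
  shows "density (distr lborel borel (\<lambda>x::'a. (norm x)\<^sup>2)) (\<lambda>_. ennreal (1 / unit_ball_vol n))
           = power_measure (n / 2)"
proof (rule power_measure_eqI)
  have n: "n > 0" by (simp add: n_def)
  then have V: "unit_ball_vol n > 0" by simp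
  show "emeasure (density (distr lborel borel (\<lambda>x::'a. (norm x)\<^sup>2)) (\<lambda>_. ennreal (1
      / unit_ball_vol n))) {..<v}
      = ennreal (v powr (n / 2))" if v: "v > 0" for v
  proof -
    have "norm x < sqrt v \<longleftrightarrow> (norm x)\<^sup>2 < v" for x :: 'a
      using v real_sqrt_less_iff[of "(norm x)\<^sup>2" v] by simp
    then have "(\<lambda>x::'a. (norm x)\<^sup>2) -` {..<v} = ball 0 (sqrt v)"
      by (auto simp: dist_norm)
    moreover have "emeasure lborel (ball (0::'a) (sqrt v))
        = ennreal (unit_ball_vol n * v powr (n / 2))"
      using v by (simp add: emeasure_ball n_def powr_half_sqrt[symmetric] powr_realpow[symmetric]
          powr_powr)
    ultimately show ?thesis
      using V by (simp add: emeasure_density_const emeasure_distr ennreal_mult[symmetric])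
  qed
  show "emeasure (density (distr lborel borel (\<lambda>x::'a. (norm x)\<^sup>2)) (\<lambda>_. ennreal (1
      / unit_ball_vol n))) {..<v}
      = 0" if v: "v \<le> 0" for v
  proof -
    have "\<not> (norm x)\<^sup>2 < v" for x :: 'a
      using v by (meson not_less order_trans zero_le_power2)
    then have "(\<lambda>x::'a. (norm x)\<^sup>2) -` {..<v} = {}" by auto
    then show ?thesis by (simp add: emeasure_density_const emeasure_distr)
  qed
qed (simp_all add: n_def)

text \<open>Integration of a radial function. The variable is the squared radius, so that Gaussians
  become exponentials and radial integrals become Laplace transforms.\<close>

lemma integral_radial:
  fixes f :: "real \<Rightarrow> real"
  assumes [measurable]: "f \<in> borel_measurable borel"
  defines "n \<equiv> real DIM('a::euclidean_space)"
  shows "(\<integral>x. f ((norm (x::'a))\<^sup>2) \<partial>lborel) =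
     unit_ball_vol n * (n / 2) * (\<integral>v. indicator {0<..} v * v powr (n / 2 - 1) * f v \<partial>lborel)"
proof -
  have n: "n > 0" by (simp add: n_def)
  then have V: "unit_ball_vol n > 0" by simp
  have "(\<integral>v. f v \<partial>power_measure (n / 2)) = (1 / unit_ball_vol n) * (\<integral>x. f ((norm (x::'a))\<^sup>2)
      \<partial>lborel)"
    using V unfolding n_def density_distr_norm_sq[where 'a='a, symmetric]
    by (subst integral_density) (auto simp: integral_distr)
  moreover have "(\<integral>v. f v \<partial>power_measure (n / 2))
      = (\<integral>v. (n / 2) * (indicator {0<..} v * v powr (n / 2 - 1) * f v) \<partial>lborel)"
    using n unfolding power_measure_def
    by (simp add: integral_density mult_ac)
  ultimately show ?thesis using V by (simp add: field_simps)
qed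

lemma gaussian_fourier_real:
  fixes s w :: real
  assumes s: "s > 0"
  shows "integrable lborel (\<lambda>x. iexp (w * x) * exp (- (s * x\<^sup>2)))"
    and "(\<integral>x. iexp (w * x) * exp (- (s * x\<^sup>2)) \<partial>lborel)
           = complex_of_real (sqrt (pi / s) * exp (- (w\<^sup>2 / (4 * s))))"
proof -
  define c where "c = 1 / sqrt (2 * s)"
  have c: "c > 0" "c\<^sup>2 = 1 / (2 * s)" using s by (auto simp: c_def power_divide)
  let ?f = "\<lambda>x. iexp (w * x) * exp (- (s * x\<^sup>2))"
  have f: "?f (0 + c * x) = sqrt (2 * pi) * (std_normal_density x *\<^sub>R iexp ((w * c) * x))" for x
    using s by (simp add: std_normal_density_def scaleR_conv_of_real power_mult_distrib c mult_ac)
  have int: "integrable lborel (\<lambda>x. std_normal_density x *\<^sub>R iexp ((w * c) * x))"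
    by (rule Bochner_Integration.integrable_bound[OF integrable_std_normal_moment[of 0]])
       (auto simp: norm_mult)
  have val: "(\<integral>x. std_normal_density x *\<^sub>R iexp ((w * c) * x) \<partial>lborel)
      = complex_of_real (exp (- ((w * c)\<^sup>2) / 2))"
    using fun_cong[OF char_std_normal_distribution, of "w * c"]
    unfolding char_def by (subst (asm) integral_density) auto
  have "integrable lborel (\<lambda>x. ?f (0 + c * x))"
    unfolding f using int by (intro integrable_mult_right)
  then show "integrable lborel ?f"
    using lborel_integrable_real_affine_iff[of c ?f 0] c by simp
  have "(\<integral>x. ?f x \<partial>lborel) = \<bar>c\<bar> *\<^sub>R (\<integral>x. ?f (0 + c * x) \<partial>lborel)"
    using c by (intro lborel_integral_real_affine) auto
  also have "\<dots> = complex_of_real (c * sqrt (2 * pi) * exp (- ((w * c)\<^sup>2) / 2))"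
    unfolding f integral_mult_right_zero val using c by (simp add: scaleR_conv_of_real)
  also have "c * sqrt (2 * pi) = sqrt (pi / s)"
    using s by (simp add: c_def real_sqrt_mult real_sqrt_divide)
  also have "- ((w * c)\<^sup>2) / 2 = - (w\<^sup>2 / (4 * s))"
    by (simp add: power_mult_distrib c)
  finally show "(\<integral>x. ?f x \<partial>lborel) = complex_of_real (sqrt (pi / s) * exp (- (w\<^sup>2 / (4 * s))))" .
qed

lemma gaussian_fourier:
  fixes u :: "'a::euclidean_space"
  assumes s: "s > 0"
  shows "integrable lborel (\<lambda>x::'a. iexp (x \<bullet> u) * exp (- (s * (norm x)\<^sup>2)))"
    and "(\<integral>x. iexp (x \<bullet> u) * exp (- (s * (norm x)\<^sup>2)) \<partial>lborel)
           = complex_of_real ((pi / s) powr (DIM('a) / 2) * exp (- ((norm u)\<^sup>2 / (4 * s))))"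
proof -
  interpret product_sigma_finite "\<lambda>b::'a. lborel :: real measure" ..
  let ?f = "\<lambda>x::'a. iexp (x \<bullet> u) * exp (- (s * (norm x)\<^sup>2))"
  let ?g = "\<lambda>b y. iexp ((u \<bullet> b) * y) * exp (- (s * y\<^sup>2))"
  let ?S = "\<lambda>f. \<Sum>b\<in>Basis. f b *\<^sub>R (b::'a)"
  have S [measurable]: "?S \<in> measurable (\<Pi>\<^sub>M b\<in>Basis. lborel) borel"
    by measurable
  have f: "?f (?S f) = (\<Prod>b\<in>Basis. ?g b (f b))" for f
  proof -
    have ip: "?S f \<bullet> u = (\<Sum>b\<in>Basis. (u \<bullet> b) * f b)"
      by (simp add: inner_sum_left inner_commute[of u] mult.commute)
    have nm: "(norm (?S f))\<^sup>2 = (\<Sum>b\<in>Basis. (f b)\<^sup>2)"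
      by (simp only: power2_norm_eq_inner, subst euclidean_inner) (simp add: power2_eq_square)
    have e1: "iexp (\<Sum>b\<in>Basis. (u \<bullet> b) * f b) = (\<Prod>b\<in>Basis. iexp ((u \<bullet> b) * f b))"
      by (simp add: exp_sum[symmetric] sum_distrib_left)
    have e2: "exp (- (s * (\<Sum>b\<in>(Basis::'a set). (f b)\<^sup>2)))
        = (\<Prod>b\<in>(Basis::'a set). exp (- (s * (f b)\<^sup>2)))"
      by (simp add: exp_sum[symmetric] sum_distrib_left sum_negf)
    show ?thesis
      unfolding ip nm e1 e2 by (simp only: prod.distrib of_real_prod)
  qed
  have int: "integrable (\<Pi>\<^sub>M b\<in>(Basis::'a set). lborel) (\<lambda>f. \<Prod>b\<in>Basis. ?g b (f b))"
    by (rule product_integrable_prod[where f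
        = ?g]) (rule finite_Basis gaussian_fourier_real(1)[OF s])+
  show "integrable lborel ?f"
    unfolding lborel_eq[where 'a='a]
    by (subst integrable_distr_eq[OF S]) (measurable, simp only: f int)
  have "(\<integral>x. ?f x \<partial>lborel) = (\<integral>f. (\<Prod>b\<in>Basis. ?g b (f b)) \<partial>(\<Pi>\<^sub>M b\<in>(Basis::'a set). lborel))"
    unfolding lborel_eq[where 'a='a]
    by (subst integral_distr[OF S]) (measurable, simp only: f)
  also have "\<dots> = (\<Prod>b\<in>(Basis::'a set). \<integral>y. ?g b y \<partial>lborel)"
    by (rule product_integral_prod[where f
        = ?g]) (rule finite_Basis gaussian_fourier_real(1)[OF s])+
  also have "\<dots> = complex_of_real (\<Prod>b\<in>(Basis::'a set). sqrt (pi / s)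
      * exp (- ((u \<bullet> b)\<^sup>2 / (4 * s))))"
    unfolding gaussian_fourier_real(2)[OF s] by simp
  also have "(\<Prod>b\<in>(Basis::'a set). sqrt (pi / s) * exp (- ((u \<bullet> b)\<^sup>2 / (4 * s))))
     = sqrt (pi / s) ^ DIM('a) * exp (- ((norm u)\<^sup>2 / (4 * s)))"
  proof -
    have "(norm u)\<^sup>2 = (\<Sum>b\<in>Basis. (u \<bullet> b)\<^sup>2)"
      by (simp only: power2_norm_eq_inner, subst euclidean_inner) (simp add: power2_eq_square)
    then show ?thesis
      by (simp add: prod.distrib exp_sum[symmetric] sum_negf sum_divide_distrib)
  qed
  also have "sqrt (pi / s) ^ DIM('a) = (pi / s) powr (DIM('a) / 2)"
    using s by (simp add: powr_half_sqrt[symmetric] powr_powr powr_realpow[symmetric])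
  finally show "(\<integral>x. ?f x \<partial>lborel) = complex_of_real ((pi / s) powr (DIM('a) / 2)
      * exp (- ((norm u)\<^sup>2 / (4 * s))))" .
qed

lemma gaussian_fourier_cos:
  fixes u :: "'a::euclidean_space"
  assumes s: "s > 0"
  shows "integrable lborel (\<lambda>x::'a. exp (- (s * (norm x)\<^sup>2)))"
    and "(\<integral>x. exp (- (s * (norm x)\<^sup>2)) * cos (x \<bullet> u) \<partial>lborel)
           = (pi / s) powr (DIM('a) / 2) * exp (- ((norm u)\<^sup>2 / (4 * s)))"
proof -
  have re: "Re (iexp (x \<bullet> u) * exp (- (s * (norm x)\<^sup>2))) = exp (- (s * (norm x)\<^sup>2)) * cos (x \<bullet> u)"
      for x u :: 'a
    by (simp add: Re_exp mult.commute)
  show "integrable lborel (\<lambda>x::'a. exp (- (s * (norm x)\<^sup>2)))"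
    using integrable_Re[OF gaussian_fourier(1)[OF s, of "0::'a"]] unfolding re by simp
  show "(\<integral>x. exp (- (s * (norm x)\<^sup>2)) * cos (x \<bullet> u) \<partial>lborel)
           = (pi / s) powr (DIM('a) / 2) * exp (- ((norm u)\<^sup>2 / (4 * s)))"
    using integral_Re[OF gaussian_fourier(1)[OF s, of u]] unfolding re gaussian_fourier(2)[OF s]
        by simp
qed

text \<open>Fubini's theorem: a Gaussian average of a characteristic function is a Gaussian average of
  the measure. The factor \<open>r\<close> rescales the measure.\<close>

lemma gaussian_duality:
  fixes F :: "'a::euclidean_space measure"
  assumes "finite_measure F" and sets [measurable_cong]: "sets F = sets borel" and s: "s > 0"
  shows "(\<integral>x. exp (- (s * (norm x)\<^sup>2)) * (\<integral>u. cos (x \<bullet> (r *\<^sub>R u)) \<partial>F) \<partial>lborel)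
     = (pi / s) powr (DIM('a) / 2) * (\<integral>u. exp (- ((norm (r *\<^sub>R u))\<^sup>2 / (4 * s))) \<partial>F)"
proof -
  interpret F: finite_measure F by fact
  interpret pair_sigma_finite "lborel :: 'a measure" F ..
  let ?g = "\<lambda>(x::'a) (u::'a). exp (- (s * (norm x)\<^sup>2))"
  let ?f = "\<lambda>(x::'a) (u::'a). exp (- (s * (norm x)\<^sup>2)) * cos (x \<bullet> (r *\<^sub>R u))"
  have "integrable (lborel \<Otimes>\<^sub>M F) (case_prod ?g)"
  proof (rule Fubini_integrable)
    show "integrable lborel (\<lambda>x. \<integral>u. norm (case_prod ?g (x, u)) \<partial>F)"
      using gaussian_fourier_cos(1)[OF s, where 'a='a] by simp
  qed auto
  then have "integrable (lborel \<Otimes>\<^sub>M F) (case_prod ?f)"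
    by (rule Bochner_Integration.integrable_bound) (auto simp: abs_mult split_beta)
  from Fubini_integral[OF this]
  show ?thesis
    by (simp only: gaussian_fourier_cos(2)[OF s] integral_mult_right_zero)
qed

section \<open>Regular variation\<close>

text \<open>Regular variation of index \<open>\<rho>\<close> at infinity, for functions that are positive on \<open>(0, \<infinity>)\<close>;
  the values elsewhere play no role. Measurability is not required: the uniform bounds below
  come from monotonicity.\<close>

definition regularly_varying :: "real \<Rightarrow> (real \<Rightarrow> real) \<Rightarrow> bool" where
  "regularly_varying \<rho> a \<longleftrightarrow>
     (\<forall>x>0. a x > 0) \<and> (\<forall>t>0. ((\<lambda>x. a (x * t) / a x) \<longlongrightarrow> t powr \<rho>) at_top)"

lemma tendsto_regularly_varying_scale:
  assumes a: "regularly_varying \<rho> a" and f: "((\<lambda>x. f x / a x) \<longlongrightarrow> c) at_top" and t: "t > 0"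
  shows "((\<lambda>x. f (x * t) / a x) \<longlongrightarrow> c * t powr \<rho>) at_top"
proof -
  have "filterlim (\<lambda>x. x * t) at_top at_top"
    using t filterlim_at_top_mult_tendsto_pos[OF tendsto_const t filterlim_ident] by simp
  then have "((\<lambda>x. f (x * t) / a (x * t)) \<longlongrightarrow> c) at_top"
    by (rule filterlim_compose[OF f])
  moreover have "((\<lambda>x. a (x * t) / a x) \<longlongrightarrow> t powr \<rho>) at_top"
    using a t by (simp add: regularly_varying_def)
  ultimately have "((\<lambda>x. f (x * t) / a (x * t) * (a (x * t) / a x)) \<longlongrightarrow> c * t powr \<rho>) at_top"
    by (rule tendsto_mult)
  then show ?thesis
  proof (rule Lim_transform_eventually)
    show "\<forall>\<^sub>F x in at_top. f (x * t) / a (x * t) * (a (x * t) / a x) = f (x * t) / a x"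
      using eventually_gt_at_top[of 0]
    proof eventually_elim
      case (elim x)
      then have "a (x * t) > 0" using a t by (simp add: regularly_varying_def)
      then show ?case by simp
    qed
  qed
qed

lemma regularly_varying_ratio:
  assumes a: "regularly_varying \<rho> a" and f: "((\<lambda>x. f x / a x) \<longlongrightarrow> c) at_top" and c: "c > 0"
    and t: "t > 0"
  shows "\<forall>\<^sub>F x in at_top. f x > 0" "((\<lambda>x. f (x * t) / f x) \<longlongrightarrow> t powr \<rho>) at_top"
proof -
  have apos: "\<forall>\<^sub>F x in at_top. a x > 0"
    using a by (intro eventually_mono[OF eventually_gt_at_top[of 0]])
        (auto simp: regularly_varying_def)
  from order_tendstoD(1)[OF f c] apos show pos: "\<forall>\<^sub>F x in at_top. f x > 0"
    by eventually_elim (simp add: zero_less_divide_iff)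
  have "((\<lambda>x. (f (x * t) / a x) / (f x / a x)) \<longlongrightarrow> (c * t powr \<rho>) / c) at_top"
    using c by (intro tendsto_divide tendsto_regularly_varying_scale[OF a f t] f) auto
  then have "((\<lambda>x. (f (x * t) / a x) / (f x / a x)) \<longlongrightarrow> t powr \<rho>) at_top"
    using c by simp
  then show "((\<lambda>x. f (x * t) / f x) \<longlongrightarrow> t powr \<rho>) at_top"
  proof (rule Lim_transform_eventually)
    show "\<forall>\<^sub>F x in at_top. f (x * t) / a x / (f x / a x) = f (x * t) / f x"
      using apos by eventually_elim simp
  qed
qed

text \<open>A positive index makes \<open>f (2 * x) / f x\<close> eventually exceed a constant greater than \<open>1\<close>,
  and iterating the doubling contradicts boundedness.\<close>

lemma regularly_varying_unbounded:
  assumes a: "regularly_varying \<rho> a" and f: "((\<lambda>x. f x / a x) \<longlongrightarrow> c) at_top" and c: "c > 0"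
    and \<rho>: "\<rho> > 0" and K: "\<And>x. x > 0 \<Longrightarrow> f x \<le> K"
  shows False
proof -
  define d where "d = 2 powr (\<rho> / 2)"
  have d: "1 < d" "d < 2 powr \<rho>"
    unfolding d_def using \<rho> by (auto intro: gr_one_powr)
  note ratio = regularly_varying_ratio[OF a f c, of 2, simplified]
  have "\<forall>\<^sub>F x in at_top. f x > 0 \<and> d < f (x * 2) / f x \<and> x > 0"
    using ratio(1) order_tendstoD(1)[OF ratio(2) d(2)] eventually_gt_at_top[of 0]
    by eventually_elim auto
  then obtain R where R: "\<And>x. x \<ge> R \<Longrightarrow> f x > 0 \<and> d < f (x * 2) / f x \<and> x > 0"
    by (auto simp: eventually_at_top_linorder)
  have R0: "R > 0" using R[of R] by auto
  have step: "d * f x \<le> f (x * 2)" if "x \<ge> R" for x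
    using R[OF that] by (auto simp: pos_less_divide_eq less_imp_le)
  have iter: "d ^ k * f R \<le> f (R * 2 ^ k)" for k
  proof (induction k)
    case (Suc k)
    have "R \<le> R * 2 ^ k" using R0 by simp
    from step[OF this] have "d * f (R * 2 ^ k) \<le> f (R * 2 ^ Suc k)" by (simp add: mult_ac)
    moreover have "d * (d ^ k * f R) \<le> d * f (R * 2 ^ k)" using Suc d by simp
    ultimately show ?case by simp
  qed simp
  obtain k where "K / f R < d ^ k" using real_arch_pow[OF d(1)] by blast
  then have "K < d ^ k * f R" using R[of R] by (simp add: field_simps)
  also have "\<dots> \<le> f (R * 2 ^ k)" by (rule iter)
  also have "\<dots> \<le> K" using R0 by (intro K) simp
  finally show False by simp
qed

text \<open>By induction on the number of doublings that lead from \<open>x\<close> past \<open>y\<close>.\<close>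

lemma monotone_doubling_bound:
  fixes f :: "real \<Rightarrow> real"
  assumes R: "R > 0" and q: "q \<ge> 0"
    and anti: "\<And>x y. R \<le> x \<Longrightarrow> x \<le> y \<Longrightarrow> f y \<le> f x"
    and pos: "\<And>x. R \<le> x \<Longrightarrow> f x \<ge> 0"
    and doubling: "\<And>x. R \<le> x \<Longrightarrow> f x \<le> 2 powr q * f (2 * x)"
    and xy: "R \<le> x" "x \<le> y"
  shows "f x \<le> 2 powr q * (y / x) powr q * f y"
proof -
  have "f x \<le> 2 powr q * (y / x) powr q * f y" if "R \<le> x" "x \<le> y" "y \<le> 2 ^ k * x" for k x
    using that
  proof (induction k arbitrary: x)
    case 0
    then have "y = x" by simp
    then show ?case
      using doubling[OF 0(1)] anti[of x "2
          * x"] 0 R mult_right_mono[OF ge_one_powr_ge_zero[of 2 q] pos[OF 0(1)]] q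
      by simp
  next
    case (Suc k)
    show ?case
    proof (cases "y \<le> 2 * x")
      case True
      have "f x \<le> 2 powr q * f (2 * x)" by (rule doubling) fact
      also have "\<dots> \<le> 2 powr q * f y"
        using anti[of y "2 * x"] True Suc.prems by simp
      also have "\<dots> \<le> 2 powr q * (y / x) powr q * f y"
      proof -
        have "1 \<le> (y / x) powr q" using q R Suc.prems by (intro ge_one_powr_ge_zero) auto
        then show ?thesis using pos[of y] Suc.prems
          by (intro mult_right_mono) auto
      qed
      finally show ?thesis .
    next
      case False
      have "f x \<le> 2 powr q * f (2 * x)" by (rule doubling) fact
      also have "\<dots> \<le> 2 powr q * (2 powr q * (y / (2 * x)) powr q * f y)"
        using Suc.prems False R by (intro mult_left_mono Suc.IH) auto
      also have "2 powr q * (y / (2 * x)) powr q = (y / x) powr q"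
        using R Suc.prems by (simp add: powr_mult[symmetric])
      finally show ?thesis by (simp add: mult.assoc)
    qed
  qed
  moreover obtain k where "y / x < 2 ^ k" using real_arch_pow[of 2 "y / x"] by auto
  then have "y \<le> 2 ^ k * x" using R xy by (simp add: field_simps)
  ultimately show ?thesis using xy by blast
qed

text \<open>A bound of Potter type, and the source of all dominating functions below. It concerns a
  function \<open>f\<close> asymptotic to a multiple of a regularly varying \<open>a\<close> such that \<open>x powr p * f x\<close>
  eventually decreases. The monotonicity replaces the uniform convergence theorem for slowly
  varying functions: to the right of \<open>r\<close> it bounds \<open>f\<close> directly, to the left it reduces the
  bound to iterated doubling.\<close>

lemma regularly_varying_bound:
  fixes f a :: "real \<Rightarrow> real"
  assumes a: "regularly_varying (- \<alpha>) a" and f: "((\<lambda>x. f x / a x) \<longlongrightarrow> c) at_top" and c: "c > 0"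
    and anti: "\<And>x y. N < x \<Longrightarrow> x \<le> y \<Longrightarrow> y powr p * f y \<le> x powr p * f x"
    and K: "\<And>x. x > 0 \<Longrightarrow> \<bar>f x\<bar> \<le> K"
    and q: "\<alpha> < q" "0 \<le> q" "p \<le> q"
  obtains R C where "R > 0" "C > 0" "\<And>r. r \<ge> R \<Longrightarrow> f r > 0"
    "\<And>r x. r \<ge> R \<Longrightarrow> x > 0 \<Longrightarrow> \<bar>f (r * x)\<bar> / a r \<le> C * (x powr (- q) + x powr (- p))"
proof -
  have apos: "a x > 0" if "x > 0" for x using a that by (simp add: regularly_varying_def)
  note ratio = regularly_varying_ratio[OF a f c, of 2, simplified]
  have "2 powr (- q) < 2 powr (- \<alpha>)" using q by simp
  note ev = order_tendstoD(1)[OF ratio(2) this]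
  have c2: "c < 2 * c" using c by simp
  have "\<forall>\<^sub>F x in at_top. f x > 0 \<and> 2 powr (- q) < f (x * 2) / f x \<and> f x / a x < 2 * c \<and> x > max 0 N"
    using ratio(1) ev order_tendstoD(2)[OF f c2] eventually_gt_at_top[of "max 0 N"]
    by eventually_elim auto
  then obtain R where R: "\<And>x. x \<ge> R \<Longrightarrow>
      f x > 0 \<and> 2 powr (- q) < f (x * 2) / f x \<and> f x / a x < 2 * c \<and> x > max 0 N"
    by (auto simp: eventually_at_top_linorder)
  have R0: "R > 0" using R[of R] by auto
  have doubling: "x powr p * f x \<le> 2 powr (q - p) * ((2 * x) powr p * f (2 * x))" if "x \<ge> R" for x
  proof -
    have "2 powr (- q) * f x \<le> f (2 * x)"
      using R[OF that] by (auto simp: pos_less_divide_eq less_imp_le mult.commute[of x 2])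
    then have "2 powr q * (2 powr (- q) * f x) \<le> 2 powr q * f (2 * x)"
      by (intro mult_left_mono) auto
    then have "f x \<le> 2 powr q * f (2 * x)"
      by (simp add: mult.assoc[symmetric] powr_add[symmetric])
    then have "x powr p * f x \<le> x powr p * (2 powr q * f (2 * x))"
      by (intro mult_left_mono) auto
    also have "\<dots> = 2 powr (q - p) * ((2 * x) powr p * f (2 * x))"
      using R[OF that] by (simp add: powr_mult powr_diff)
    finally show ?thesis .
  qed
  have potter: "f x \<le> 2 powr (q - p) * ((y / x) powr q * f y)" if xy: "R \<le> x" "x \<le> y" for x y
  proof -
    have x: "x > 0" "y > 0" using xy R0 by auto
    have "x powr p * f x \<le> 2 powr (q - p) * (y / x) powr (q - p) * (y powr p * f y)"
    proof (rule monotone_doubling_bound[where f = "\<lambda>x. x powr p * f x" and q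
        = "q - p", OF R0 _ _ _ doubling xy])
      show "v powr p * f v \<le> u powr p * f u" if "R \<le> u" "u \<le> v" for u v
        using anti[of u v] R[of u] that by simp
      show "0 \<le> u powr p * f u" if "R \<le> u" for u using R[OF that] by simp
    qed (use q in auto)
    then have "f x \<le> 2 powr (q - p) * ((y / x) powr (q - p) * (y powr p / x powr p) * f y)"
      using x by (simp add: field_simps)
    also have "(y / x) powr (q - p) * (y powr p / x powr p) = (y / x) powr q"
      using x by (simp add: powr_divide[symmetric] powr_add[symmetric])
    finally show ?thesis .
  qed
  \<comment> \<open>The summand \<open>K / f R\<close> takes care of arguments below \<open>R\<close>, where only \<open>\<bar>f\<bar> \<le> K\<close> is known.\<close>
  define D where "D = 2 powr (q - p) * (1 + K / f R)"
  have fR: "f R > 0" using R[of R] by simp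
  have K0: "K \<ge> 0" using K[of 1] by linarith
  have D: "D > 0" using K0 fR by (simp add: D_def add_pos_nonneg)
  have below: "\<bar>f x\<bar> \<le> D * ((y / x) powr q * f y)" if xy: "0 < x" "x \<le> y" "R \<le> y" for x y
  proof (cases "R \<le> x")
    case True
    have "\<bar>f x\<bar> = f x" using R[OF True] by simp
    also have "\<dots> \<le> 2 powr (q - p) * ((y / x) powr q * f y)" by (rule potter) (use True xy in auto)
    also have "\<dots> \<le> D * ((y / x) powr q * f y)"
      using K0 fR R[OF xy(3)] by (intro mult_right_mono) (auto simp: D_def)
    finally show ?thesis .
  next
    case False
    have "\<bar>f x\<bar> \<le> K" by (rule K) fact
    also have "K = (K / f R) * f R" using fR by simp
    also have "\<dots> \<le> (K / f R) * (2 powr (q - p) * ((y / R) powr q * f y))"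
      using potter[of R y] xy K0 fR by (intro mult_left_mono) auto
    also have "\<dots> \<le> (K / f R) * (2 powr (q - p) * ((y / x) powr q * f y))"
      using False xy q R0 K0 fR R[OF xy(3)]
      by (intro mult_left_mono mult_right_mono powr_mono2 divide_left_mono) auto
    also have "\<dots> \<le> D * ((y / x) powr q * f y)"
      using R[OF xy(3)] by (simp add: D_def algebra_simps)
    finally show ?thesis .
  qed
  have above: "\<bar>f y\<bar> \<le> (y / x) powr (- p) * f x" if xy: "R \<le> x" "x \<le> y" for x y
  proof -
    have x: "x > 0" "y > 0" using xy R0 by auto
    have "y powr p * f y \<le> x powr p * f x" using anti[of x y] R[of x] xy by simp
    then have "f y \<le> (x powr p / y powr p) * f x" using x by (simp add: field_simps)
    also have "x powr p / y powr p = (y / x) powr (- p)"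
      using x by (simp add: powr_divide powr_minus field_simps)
    finally show ?thesis using R[of y] xy by simp
  qed
  show ?thesis
  proof
    show "R > 0" by (rule R0)
    show "2 * c * (D + 1) > 0" using c D by simp
    show "f r > 0" if "r \<ge> R" for r using R[OF that] by simp
    show "\<bar>f (r * x)\<bar> / a r \<le> 2 * c * (D + 1) * (x powr (- q) + x powr (- p))"
      if r: "r \<ge> R" and x: "x > 0" for r x
    proof -
      have ar: "a r > 0" using apos r R0 by simp
      have "\<bar>f (r * x)\<bar> \<le> (D * x powr (- q) + x powr (- p)) * f r"
      proof (cases "x \<le> 1")
        case True
        have "\<bar>f (r * x)\<bar> \<le> D * ((r / (r * x)) powr q * f r)"
          using r x R0 True by (intro below) (auto simp: mult_left_le)
        also have "(r / (r * x)) powr q = x powr (- q)"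
          using x r R0 by (simp add: powr_divide powr_minus field_simps)
        also have "D * (x powr (- q) * f r) \<le> (D * x powr (- q) + x powr (- p)) * f r"
          using R[OF r] by (simp add: algebra_simps)
        finally show ?thesis .
      next
        case False
        have "\<bar>f (r * x)\<bar> \<le> ((r * x) / r) powr (- p) * f r"
          using r x R0 False by (intro above) auto
        also have "(r * x) / r = x" using r R0 by simp
        also have "x powr (- p) * f r \<le> (D * x powr (- q) + x powr (- p)) * f r"
          using R[OF r] D by (intro mult_right_mono) auto
        finally show ?thesis .
      qed
      also have "\<dots> \<le> (D * x powr (- q) + x powr (- p)) * (2 * c * a r)"
        using R[OF r] ar D by (intro mult_left_mono) (auto simp: field_simps)
      also have "\<dots> \<le> ((D + 1) * (x powr (- q) + x powr (- p))) * (2 * c * a r)"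
        using ar c D by (intro mult_right_mono) (auto simp: algebra_simps)
      finally show ?thesis using ar by (simp add: field_simps)
    qed
  qed
qed

section \<open>Abelian and Tauberian theorems for Laplace transforms\<close>

lemma has_bochner_integral_exp_powr:
  fixes s b :: real
  assumes "s > 0" "b > 0"
  shows "has_bochner_integral lborel (\<lambda>v. indicator {0<..} v * v powr (b - 1) * exp (- (s * v)))
           (Gamma b * s powr (- b))"
  using assms nn_integral_exp_powr[OF assms] Gamma_real_pos[of b]
  by (intro has_bochner_integral_nn_integral) (auto simp: mult.assoc)

text \<open>Substituting the asymptotics of \<open>f\<close> under a Laplace integral, by dominated convergence.
  The exponent \<open>e\<close> may have either sign: \<open>1/2\<close> is used for the covariance and \<open>- 1/2\<close> for the
  spectral distribution function.\<close>

lemma laplace_abelian: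
  fixes f a :: "real \<Rightarrow> real"
  assumes a: "regularly_varying (- \<alpha>) a" and f: "((\<lambda>x. f x / a x) \<longlongrightarrow> c) at_top" and c: "c > 0"
    and anti: "\<And>x y. N < x \<Longrightarrow> x \<le> y \<Longrightarrow> y powr p * f y \<le> x powr p * f x"
    and K: "\<And>x. x > 0 \<Longrightarrow> \<bar>f x\<bar> \<le> K"
    and q: "\<alpha> < q" "0 \<le> q" "p \<le> q"
    and [measurable]: "f \<in> borel_measurable borel"
    and b: "b - e * q > 0" "b - e * p > 0" "b - e * \<alpha> > 0" and s: "s > 0"
  shows "((\<lambda>r. (\<integral>v. indicator {0<..} v * v powr (b - 1) * exp (- (s * v)) * f (r * v powr e)
      \<partial>lborel) / a r)
     \<longlongrightarrow> c * (Gamma (b - e * \<alpha>) * s powr (- (b - e * \<alpha>)))) at_top"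
proof -
  let ?w = "\<lambda>z v. indicator {0<..} v * v powr (b - e * z - 1) * exp (- (s * v))"
  obtain R C where R: "R > 0" "C > 0"
    "\<And>r x. r \<ge> R \<Longrightarrow> x > 0 \<Longrightarrow> \<bar>f (r * x)\<bar> / a r \<le> C * (x powr (- q) + x powr (- p))"
    using regularly_varying_bound[OF a f c anti K q] by metis
  have apos: "a x > 0" if "x > 0" for x using a that by (simp add: regularly_varying_def)
  have int: "integrable lborel (?w z)" if "b - e * z > 0" for z
    using has_bochner_integral_exp_powr[OF s that] by (simp add: has_bochner_integral_iff)
  have "((\<lambda>r. \<integral>v. indicator {0<..} v * v powr (b - 1) * exp (- (s * v)) * f (r * v powr e) / a r
      \<partial>lborel)
     \<longlongrightarrow> (\<integral>v. c * ?w \<alpha> v \<partial>lborel)) at_top"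
  proof (rule integral_dominated_convergence_at_top[where w = "\<lambda>v. C * (?w q v + ?w p v)"])
    show "integrable lborel (\<lambda>v. C * (?w q v + ?w p v))"
      using int[OF b(1)] int[OF b(2)] by simp
    show "AE v in lborel. ((\<lambda>r. indicator {0<..} v * v powr (b - 1) * exp (- (s * v))
        * f (r * v powr e) / a r)
        \<longlongrightarrow> c * ?w \<alpha> v) at_top"
    proof (rule AE_I2)
      fix v :: real
      show "((\<lambda>r. indicator {0<..} v * v powr (b - 1) * exp (- (s * v)) * f (r * v powr e) / a r)
        \<longlongrightarrow> c * ?w \<alpha> v) at_top"
      proof (cases "v > 0")
        case True
        have "((\<lambda>r. (v powr (b - 1) * exp (- (s * v))) * (f (r * v powr e) / a r)) \<longlongrightarrow>
           (v powr (b - 1) * exp (- (s * v))) * (c * (v powr e) powr (- \<alpha>))) at_top"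
          using True by (intro tendsto_mult_left tendsto_regularly_varying_scale[OF a f]) auto
        also have "(v powr (b - 1) * exp (- (s * v))) * (c * (v powr e) powr (- \<alpha>)) = c * ?w \<alpha> v"
          using True by (simp add: powr_powr powr_add[symmetric] algebra_simps)
        finally show ?thesis using True by simp
      qed simp
    qed
    show "\<forall>\<^sub>F r in at_top. AE v in lborel.
        norm (indicator {0<..} v * v powr (b - 1) * exp (- (s * v)) * f (r * v powr e) / a r)
            \<le> C * (?w q v + ?w p v)"
      using eventually_ge_at_top[of R]
    proof (eventually_elim, intro AE_I2)
      fix r v :: real assume r: "R \<le> r"
      show "norm (indicator {0<..} v * v powr (b - 1) * exp (- (s * v)) * f (r * v powr e) / a r)
          \<le> C * (?w q v + ?w p v)"
      proof (cases "v > 0")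
        case True
        have ar: "a r > 0" using r R apos by simp
        have "norm (indicator {0<..} v * v powr (b - 1) * exp (- (s * v)) * f (r * v powr e) / a r)
          = (v powr (b - 1) * exp (- (s * v))) * (\<bar>f (r * v powr e)\<bar> / a r)"
          using True ar by (simp add: abs_mult)
        also have "\<dots> \<le> (v powr (b - 1) * exp (- (s * v))) * (C * ((v powr e) powr (- q)
            + (v powr e) powr (- p)))"
          using True r by (intro mult_left_mono R) auto
        also have "\<dots> = C * (?w q v + ?w p v)"
          using True by (simp add: powr_powr powr_add[symmetric] algebra_simps)
        finally show ?thesis .
      qed simp
    qed
  qed measurable
  also have "(\<integral>v. c * ?w \<alpha> v \<partial>lborel) = c * (Gamma (b - e * \<alpha>) * s powr (- (b - e * \<alpha>)))"
    using has_bochner_integral_exp_powr[OF s b(3)] by (simp add: has_bochner_integral_iff)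
  finally show ?thesis by simp
qed

text \<open>Fubini's theorem applied to \<open>exp (- (s * \<tau> u))\<close> as the integral of \<open>s * exp (- (s * v))\<close>
  over \<open>v > \<tau> u\<close>.\<close>

lemma integral_exp_layer_cake:
  fixes F :: "'a measure" and \<tau> :: "'a \<Rightarrow> real"
  assumes "finite_measure F" and [measurable]: "\<tau> \<in> borel_measurable F"
    and \<tau>: "\<And>u. u \<in> space F \<Longrightarrow> \<tau> u \<ge> 0" and s: "s > 0"
  shows "(\<integral>u. exp (- (s * \<tau> u)) \<partial>F)
     = s * (\<integral>v. indicator {0<..} v * exp (- (s * v)) * measure F {u \<in> space F. \<tau> u < v} \<partial>lborel)"
proof -
  interpret F: finite_measure F by fact
  interpret pair_sigma_finite "lborel :: real measure" F ..
  let ?w = "\<lambda>v::real. indicator {0<..} v * exp (- (s * v))"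
  let ?f = "\<lambda>v u. ?w v * indicator {\<tau> u<..} v"
  have "has_bochner_integral lborel ?w (1 / s)"
  proof -
    have "?w = (\<lambda>v. indicator {0<..} v * v powr (1 - 1) * exp (- (s * v)))"
      by (auto simp: indicator_def)
    then show ?thesis
      using has_bochner_integral_exp_powr[OF s, of 1] s by (simp add: powr_minus_divide)
  qed
  then have w: "integrable lborel ?w" "integral\<^sup>L lborel ?w = 1 / s"
    by (auto simp: has_bochner_integral_iff)
  have meas: "(\<lambda>x. ?f (fst x) (snd x)) \<in> borel_measurable (lborel \<Otimes>\<^sub>M F)"
    unfolding indicator_def greaterThan_iff by measurable
  have "integrable (lborel \<Otimes>\<^sub>M F) (\<lambda>x. ?w (fst x))"
  proof (rule Fubini_integrable)
    show "integrable lborel (\<lambda>v. \<integral>u. norm (?w (fst (v, u))) \<partial>F)"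
      using integrable_mult_right[OF w(1), of "measure F (space F)"]
      by (simp add: abs_mult mult_ac)
  qed (auto intro!: F.integrable_const)
  then have "integrable (lborel \<Otimes>\<^sub>M F) (case_prod ?f)"
    by (rule Bochner_Integration.integrable_bound)
       (use meas in \<open>auto simp: split_beta indicator_def\<close>)
  from Fubini_integral[OF this]
  have swap: "(\<integral>u. (\<integral>v. ?f v u \<partial>lborel) \<partial>F) = (\<integral>v. (\<integral>u. ?f v u \<partial>F) \<partial>lborel)" .
  have "(\<integral>v. ?f v u \<partial>lborel) = exp (- (s * \<tau> u)) / s" if u: "u \<in> space F" for u
  proof -
    have "(\<integral>v. ?f v u \<partial>lborel) = \<bar>1\<bar> *\<^sub>R (\<integral>v. ?f (\<tau> u + 1 * v) u \<partial>lborel)"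
      by (rule lborel_integral_real_affine) simp
    also have "\<dots> = (\<integral>v. exp (- (s * \<tau> u)) * ?w v \<partial>lborel)"
      using \<tau>[OF u] by (auto intro!: Bochner_Integration.integral_cong
          simp: indicator_def exp_add[symmetric] algebra_simps)
    finally show ?thesis using w by simp
  qed
  then have inner: "(\<integral>u. (\<integral>v. ?f v u \<partial>lborel) \<partial>F) = (\<integral>u. exp (- (s * \<tau> u)) / s \<partial>F)"
    by (intro Bochner_Integration.integral_cong) auto
  have outer: "(\<integral>u. ?f v u \<partial>F) = ?w v * measure F {u \<in> space F. \<tau> u < v}" for v
  proof -
    have "(\<integral>u. ?f v u \<partial>F) = (\<integral>u. ?w v * indicator {u \<in> space F. \<tau> u < v} u \<partial>F)"
      by (intro Bochner_Integration.integral_cong) (auto simp: indicator_def)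
    then show ?thesis by simp
  qed
  have "(\<integral>u. exp (- (s * \<tau> u)) \<partial>F) / s
      = (\<integral>v. ?w v * measure F {u \<in> space F. \<tau> u < v} \<partial>lborel)"
    using swap unfolding inner outer by simp
  then show ?thesis using s by (simp add: divide_eq_eq mult.commute)
qed

lemma has_bochner_integral_powr_interval:
  fixes x m :: real
  assumes "x \<ge> 0" "m > 0"
  shows "has_bochner_integral lborel (\<lambda>v. indicator {0..x} v * v powr (m - 1)) (x powr m / m)"
  using nn_integral_has_integral_lebesgue'[OF _ has_integral_powr_from_0[of "m - 1" x]] assms
  by (intro has_bochner_integral_nn_integral)
      (auto simp: ennreal_mult' ennreal_indicator mult.commute)

text \<open>The converse for \<open>e = 1/2\<close> and a function \<open>f\<close> for which \<open>x powr p * f x\<close> eventually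
  decreases. Karamata's theorem yields the limits of the integrals of
  \<open>v powr (m - 1) * f (r * sqrt v) / a r\<close> up to \<open>w\<close>, cut off near \<open>0\<close>; the monotone density
  argument then compares increments of these integrals near \<open>w = 1\<close> with \<open>f r / a r\<close>. The
  function \<open>f\<close> need not be nonnegative near \<open>0\<close>; the assumption on \<open>r powr (- (2 * m)) / a r\<close>
  makes the part of the integral below \<open>(N / r)\<^sup>2\<close> negligible.\<close>

lemma laplace_tauberian_monotone:
  fixes f a :: "real \<Rightarrow> real"
  assumes [measurable]: "f \<in> borel_measurable borel"
    and K: "\<And>x. x > 0 \<Longrightarrow> \<bar>f x\<bar> \<le> K"
    and N: "N > 0"
    and anti: "\<And>x y. N < x \<Longrightarrow> x \<le> y \<Longrightarrow> y powr p * f y \<le> x powr p * f x"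
    and nonneg: "\<And>x. N < x \<Longrightarrow> f x \<ge> 0"
    and apos: "\<And>x. x > 0 \<Longrightarrow> a x > 0"
    and small: "((\<lambda>r. r powr (- (2 * m)) / a r) \<longlongrightarrow> 0) at_top"
    and m: "m > 0" and p: "p / 2 \<le> m - 1" and \<beta>: "\<beta> > 0"
    and lim: "\<And>s. s > 0 \<Longrightarrow>
      ((\<lambda>r. (\<integral>v. indicator {0<..} v * v powr (m - 1) * exp (- (s * v)) * f (r * v powr (1/2))
          \<partial>lborel) / a r)
     \<longlongrightarrow> Gamma \<beta> * s powr (- \<beta>)) at_top"
  shows "((\<lambda>r. f r / a r) \<longlongrightarrow> 1) at_top"
proof -
  define g where "g r v = 
    (if r > 0 then indicator {(N / r)\<^sup>2<..} v * v powr (m - 1) * f (r * v powr (1/2))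
        / a r else 0)" for r v
  let ?h = "\<lambda>s r v. indicator {0<..} v * v powr (m - 1) * exp (- (s * v)) * f (r * v powr (1/2))"
  have g_meas [measurable]: "g r \<in> borel_measurable borel" for r
    unfolding g_def by measurable
  have g_zero: "g r v = 0" if "v \<le> 0" for r v
  proof -
    have "v \<le> (N / r)\<^sup>2" by (rule order_trans[OF that zero_le_power2])
    then show ?thesis by (simp add: g_def)
  qed
  have far: "N < r * v powr (1/2)" if "r > 0" "(N / r)\<^sup>2 < v" for r v
  proof -
    have "sqrt ((N / r)\<^sup>2) < sqrt v" using that(2) by (rule real_sqrt_less_mono)
    moreover have "v \<ge> 0" using that(2) zero_le_power2[of "N / r"] by linarith
    ultimately have "N / r < v powr (1/2)"
      using that(1) N by (simp add: powr_half_sqrt)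
    then show ?thesis using that by (simp add: field_simps)
  qed
  have g_nonneg: "g r v \<ge> 0" for r v
  proof (cases "r > 0 \<and> (N / r)\<^sup>2 < v")
    case True
    then show ?thesis using nonneg[OF far[of r v]] apos[of r] by (simp add: g_def)
  qed (auto simp: g_def)
  have w: "integrable lborel (\<lambda>v. indicator {0<..} v * v powr (m - 1) * exp (- (s * v)))"
      if "s > 0" for s
    using has_bochner_integral_exp_powr[OF that m] by (simp add: has_bochner_integral_iff)
  have h_int: "integrable lborel (?h s r)" if "s > 0" "r > 0" for s r
  proof (rule Bochner_Integration.integrable_bound)
    show "integrable lborel (\<lambda>v. K * (indicator {0<..} v * v powr (m - 1) * exp (- (s * v))))"
      using w[OF that(1)] by simp
    show "AE v in lborel. norm (?h s r v) \<le> norm (K * (indicator {0<..} v * v powr (m - 1)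
        * exp (- (s * v))))"
    proof (rule AE_I2)
      fix v :: real
      have "\<bar>f (r * v powr (1/2))\<bar> \<le> \<bar>K\<bar>" if "v > 0"
        using K[of "r * v powr (1/2)"] that \<open>r > 0\<close> by simp
      then show "norm (?h s r v) \<le> norm (K * (indicator {0<..} v * v powr (m - 1)
          * exp (- (s * v))))"
        by (auto simp: abs_mult indicator_def mult_ac intro!: mult_left_mono)
    qed
  qed measurable
  have g_int: "integrable lborel (\<lambda>v. exp (- (s * v)) * g r v)" if "s > 0" for s r
  proof (cases "r > 0")
    case True
    show ?thesis
    proof (rule Bochner_Integration.integrable_bound)
      show "integrable lborel (\<lambda>v. ?h s r v / a r)" using h_int[OF that True] by simp
      show "AE v in lborel. norm (exp (- (s * v)) * g r v) \<le> norm (?h s r v / a r)"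
        using True apos[of r]
        by (intro AE_I2) (auto simp: g_def abs_mult indicator_def not_less mult_ac
            dest: order.strict_trans1[OF zero_le_power2])
    qed measurable
  qed (simp add: g_def)
  \<comment> \<open>Cutting off at \<open>(N / r)\<^sup>2\<close> to obtain a nonnegative weight does not change the limit.\<close>
  have g_lim: "((\<lambda>r. \<integral>v. exp (- (s * v)) * g r v \<partial>lborel) \<longlongrightarrow> Gamma \<beta> * s powr (- \<beta>)) at_top"
    if s: "s > 0" for s
  proof -
    have bound: "norm ((\<integral>v. exp (- (s * v)) * g r v \<partial>lborel) - (\<integral>v. ?h s r v \<partial>lborel) / a r)
        \<le> (K * N powr (2 * m) / m) * (r powr (- (2 * m)) / a r)" if r: "r > 0" for r
    proof -
      define x where "x = (N / r)\<^sup>2"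
      have x: "x \<ge> 0" by (simp add: x_def)
      have i: "integrable lborel (\<lambda>v. indicator {0..x} v * v powr (m - 1))"
         "(\<integral>v. indicator {0..x} v * v powr (m - 1) \<partial>lborel) = x powr m / m"
        using has_bochner_integral_powr_interval[OF x m] by (auto simp: has_bochner_integral_iff)
      have "norm ((\<integral>v. exp (- (s * v)) * g r v \<partial>lborel) - (\<integral>v. ?h s r v \<partial>lborel) / a r)
          = norm (\<integral>v. exp (- (s * v)) * g r v - ?h s r v / a r \<partial>lborel)"
        using g_int[OF s] h_int[OF s r] by simp
      also have "\<dots> \<le> (\<integral>v. (K / a r) * (indicator {0..x} v * v powr (m - 1)) \<partial>lborel)"
      proof (rule Bochner_Integration.integral_norm_bound_integral)
        fix v :: real
        show "norm (exp (- (s * v)) * g r v - ?h s r v / a r)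
            \<le> (K / a r) * (indicator {0..x} v * v powr (m - 1))"
        proof (cases "v \<in> {0<..x}")
          case True
          have fK: "\<bar>f (r * v powr (1/2))\<bar> \<le> K" using K True r by simp
          have "norm (exp (- (s * v)) * g r v - ?h s r v / a r)
              = v powr (m - 1) * (exp (- (s * v)) * \<bar>f (r * v powr (1/2))\<bar>) / a r"
            using True r apos[OF r] by (simp add: g_def x_def abs_mult)
          also have "\<dots> \<le> v powr (m - 1) * (1 * K) / a r"
            using True s fK apos[OF r]
            by (intro divide_right_mono mult_left_mono mult_mono) auto
          finally show ?thesis using True by (simp add: field_simps)
        next
          case False
          then have "v \<le> 0 \<or> x < v" by auto
          then have "exp (- (s * v)) * g r v - ?h s r v / a r = 0"
          proof
            assume "x < v"
            moreover have "0 < v" using \<open>x < v\<close> x by simp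
            ultimately show ?thesis using r by (simp add: g_def x_def)
          qed (simp add: g_zero)
          then show ?thesis using K[of 1] apos[OF r] by (simp add: indicator_def)
        qed
      next
        show "integrable lborel (\<lambda>v. exp (- (s * v)) * g r v - ?h s r v / a r)"
          by (intro Bochner_Integration.integrable_diff integrable_divide g_int[OF s] h_int[OF s r])
        show "integrable lborel (\<lambda>v. (K / a r) * (indicator {0..x} v * v powr (m - 1)))"
          by (intro integrable_mult_right i(1))
      qed
      also have "\<dots> = (K / a r) * (x powr m / m)" by (simp only: integral_mult_right_zero i(2))
      also have "\<dots> = (K * N powr (2 * m) / m) * (r powr (- (2 * m)) / a r)"
      proof -
        have "x = (N / r) powr 2" using N r by (simp add: x_def)
        then have "x powr m = (N / r) powr (2 * m)" by (simp only: powr_powr)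
        also have "\<dots> = N powr (2 * m) * r powr (- (2 * m))"
          using N r by (simp add: powr_divide powr_minus_divide)
        finally show ?thesis by (simp add: mult_ac)
      qed
      finally show ?thesis .
    qed
    have "((\<lambda>r. (\<integral>v. exp (- (s * v)) * g r v \<partial>lborel) - (\<integral>v. ?h s r v \<partial>lborel) / a r) \<longlongrightarrow> 0) at_top"
    proof (rule Lim_null_comparison)
      show "\<forall>\<^sub>F r in at_top. norm ((\<integral>v. exp (- (s * v)) * g r v \<partial>lborel) - (\<integral>v. ?h s r v \<partial>lborel)
          / a r)
          \<le> (K * N powr (2 * m) / m) * (r powr (- (2 * m)) / a r)"
        using eventually_gt_at_top[of 0] by eventually_elim (rule bound)
      show "((\<lambda>r. (K * N powr (2 * m) / m) * (r powr (- (2 * m)) / a r)) \<longlongrightarrow> 0) at_top"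
        using tendsto_mult_left[OF small, of "K * N powr (2 * m) / m"] by simp
    qed
    from tendsto_add[OF this lim[OF s]] show ?thesis by simp
  qed
  define J where "J w r = (\<integral>v. indicator {..<w} v * g r v \<partial>lborel)" for w r
  have J_lim: "(J w \<longlongrightarrow> (1 / \<beta>) * w powr \<beta>) at_top" if "w > 0" for w
  proof -
    \<comment> \<open>\<open>max v 0\<close> is nonnegative everywhere and agrees with \<open>v\<close> where the weight does not vanish.\<close>
    have eq: "exp (- (s * max v 0)) * g r v = exp (- (s * v)) * g r v" for s r v
      by (cases "v \<ge> 0") (auto simp: g_zero)
    have eq': "indicator {..<w} (max v 0) * g r v = indicator {..<w} v * g r v" for r v
      using that by (auto simp: indicator_def max_def)
    have G: "1 / \<beta> * (Gamma (\<beta> + 1) * s powr (- \<beta>)) = Gamma \<beta> * s powr (- \<beta>)" for s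
    proof -
      have "Gamma (\<beta> + 1) = \<beta> * Gamma \<beta>"
        using \<beta> Gamma_plus1[of \<beta>] by (metis nonpos_Ints_nonpos not_le)
      then show ?thesis using \<beta> by simp
    qed
    have "((\<lambda>r. \<integral>v. indicator {..<w} (max v 0) * g r v \<partial>lborel) \<longlongrightarrow> (1 / \<beta>) * w powr \<beta>) at_top"
    proof (rule karamata_tauberian)
      show "integrable lborel (\<lambda>v. exp (- max v 0) * g r v)" for r
        using g_int[OF zero_less_one, of r] eq[of 1 _ r] by (simp only: mult_1)
      show "((\<lambda>r. \<integral>v. exp (- (s * max v 0)) * g r v \<partial>lborel)
          \<longlongrightarrow> 1 / \<beta> * (Gamma (\<beta> + 1) * s powr (- \<beta>))) at_top" if "s > 0" for s
        unfolding eq G by (rule g_lim) fact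
    qed (use \<beta> that g_nonneg in auto)
    then show ?thesis unfolding eq' J_def .
  qed
  have ind_int: "integrable lborel (\<lambda>v. indicator {..<w} v * g r v)" for w r
  proof (rule Bochner_Integration.integrable_bound)
    show "integrable lborel (\<lambda>v. exp w * (exp (- (1 * v)) * g r v))"
      using g_int[of 1 r] by (intro integrable_mult_right) simp
    show "AE v in lborel. norm (indicator {..<w} v * g r v)
        \<le> norm (exp w * (exp (- (1 * v)) * g r v))"
    proof (rule AE_I2)
      fix v :: real
      have "1 * g r v \<le> exp (w - v) * g r v" if "v < w"
        using that g_nonneg by (intro mult_right_mono) auto
      then show "norm (indicator {..<w} v * g r v) \<le> norm (exp w * (exp (- (1 * v)) * g r v))"
        using g_nonneg[of r v] by (auto simp: indicator_def exp_diff exp_minus field_simps)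
    qed
  qed measurable
  define \<kappa> where "\<kappa> = m - 1 - p / 2"
  have \<kappa>: "\<kappa> \<ge> 0" using p by (simp add: \<kappa>_def)
  have g_le: "g r v \<le> (f r / a r) * v powr \<kappa>" if "r > N" "v \<ge> 1" for r v
  proof -
    have r: "r > 0" using that N by simp
    have "r * 1 \<le> r * v powr (1/2)"
      using that r by (intro mult_left_mono ge_one_powr_ge_zero) auto
    then have "(r * v powr (1/2)) powr p * f (r * v powr (1/2)) \<le> r powr p * f r"
      using that by (intro anti) auto
    then have "r powr p * (v powr (p / 2) * f (r * v powr (1/2))) \<le> r powr p * f r"
      using r that by (simp add: powr_mult powr_powr mult.assoc)
    then have "v powr (p / 2) * f (r * v powr (1/2)) \<le> f r" using r by simp
    then have "v powr \<kappa> * (v powr (p / 2) * f (r * v powr (1/2))) \<le> v powr \<kappa> * f r"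
      by (intro mult_left_mono) auto
    also have "v powr \<kappa> * (v powr (p / 2) * f (r * v powr (1/2)))
        = v powr (m - 1) * f (r * v powr (1/2))"
      using that by (simp add: \<kappa>_def mult.assoc[symmetric] powr_add[symmetric])
    finally have *: "v powr (m - 1) * f (r * v powr (1/2)) \<le> v powr \<kappa> * f r" .
    have "(N / r)\<^sup>2 < 1" using that N r by (simp add: power_less_one_iff abs_square_less_1)
    then have "g r v = (v powr (m - 1) * f (r * v powr (1/2))) / a r"
      using that r by (simp add: g_def)
    also have "\<dots> \<le> (v powr \<kappa> * f r) / a r"
      using * apos[OF r] by (intro divide_right_mono) auto
    finally show ?thesis by (simp add: mult.commute)
  qed
  have g_ge: "g r v \<ge> (f r / a r) * v powr \<kappa>" if "r > 0" "(N / r)\<^sup>2 < v" "v \<le> 1" for r v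
  proof -
    have v: "v > 0" using that(2) zero_le_power2[of "N / r"] by linarith
    have r: "r > 0" by fact
    have "v powr (1/2) \<le> 1 powr (1/2)" using v that by (intro powr_mono2) auto
    then have "r * v powr (1/2) \<le> r" using r by (simp add: mult_left_le)
    then have "r powr p * f r \<le> (r * v powr (1/2)) powr p * f (r * v powr (1/2))"
      using far[OF that(1,2)] by (intro anti) auto
    then have "r powr p * f r \<le> r powr p * (v powr (p / 2) * f (r * v powr (1/2)))"
      using r v by (simp add: powr_mult powr_powr mult.assoc)
    then have "f r \<le> v powr (p / 2) * f (r * v powr (1/2))" using r by simp
    then have "v powr \<kappa> * f r \<le> v powr \<kappa> * (v powr (p / 2) * f (r * v powr (1/2)))"
      by (intro mult_left_mono) auto
    also have "v powr \<kappa> * (v powr (p / 2) * f (r * v powr (1/2)))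
        = v powr (m - 1) * f (r * v powr (1/2))"
      using v by (simp add: \<kappa>_def mult.assoc[symmetric] powr_add[symmetric])
    finally have *: "v powr \<kappa> * f r \<le> v powr (m - 1) * f (r * v powr (1/2))" .
    have "(f r / a r) * v powr \<kappa> = (v powr \<kappa> * f r) / a r" by simp
    also have "\<dots> \<le> (v powr (m - 1) * f (r * v powr (1/2))) / a r"
      using * apos[OF r] by (intro divide_right_mono) auto
    also have "\<dots> = g r v" using that by (simp add: g_def)
    finally show ?thesis .
  qed
  have f_nonneg: "f r / a r \<ge> 0" if "r > N" for r
    using nonneg[OF that] apos[of r] that N by simp
  \<comment> \<open>Near \<open>w = 1\<close> the difference quotient \<open>Q w r\<close> bounds \<open>f r / a r\<close>: from below for \<open>w > 1\<close>, from
    above for \<open>w < 1\<close>.\<close>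
  define Q where "Q w r = (J w r - J 1 r) / (w powr \<kappa> * (w - 1))" for w r
  define \<phi> where "\<phi> w = ((1 / \<beta>) * w powr \<beta> - (1 / \<beta>) * 1 powr \<beta>) / (w powr \<kappa> * (w - 1))" for w
  have Q_lim: "(Q w \<longlongrightarrow> \<phi> w) at_top" if "w > 0" "w \<noteq> 1" for w
    unfolding Q_def \<phi>_def using that J_lim[of w] J_lim[of 1]
    by (intro tendsto_divide tendsto_diff tendsto_const) auto
  have Q_right: "Q w r \<le> f r / a r" if w: "w > 1" and r: "r > N" for w r
  proof -
    have "J w r - J 1 r = (\<integral>v. indicator {..<w} v * g r v - indicator {..<1} v * g r v \<partial>lborel)"
      unfolding J_def using ind_int by simp
    also have "\<dots> \<le> (\<integral>v. (f r / a r * w powr \<kappa>) * indicator {1..<w} v \<partial>lborel)"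
    proof (rule integral_mono)
      fix v :: real
      show "indicator {..<w} v * g r v - indicator {..<1} v * g r v \<le> (f r / a r * w powr \<kappa>)
          * indicator {1..<w} v"
      proof (cases "1 \<le> v \<and> v < w")
        case True
        have "g r v \<le> f r / a r * v powr \<kappa>" using g_le r True by simp
        also have "\<dots> \<le> f r / a r * w powr \<kappa>"
          using True \<kappa> f_nonneg[OF r] by (intro mult_left_mono powr_mono2) auto
        finally show ?thesis using True by simp
      next
        case False
        then show ?thesis using w by (auto simp: indicator_def)
      qed
    next
      show "integrable lborel (\<lambda>v. (f r / a r * w powr \<kappa>) * indicator {1..<w} v)"
        using w by (intro integrable_mult_right integrable_real_indicator) auto
    qed (use ind_int in auto)
    also have "\<dots> = f r / a r * (w powr \<kappa> * (w - 1))" using w by simp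
    finally show ?thesis using w by (simp add: Q_def divide_le_eq)
  qed
  have Q_left: "f r / a r \<le> Q w r" if w: "0 < w" "w < 1" and r: "r > N" "(N / r)\<^sup>2 < w" for w r
  proof -
    have r0: "r > 0" using r N by simp
    have "f r / a r * (w powr \<kappa> * (1 - w)) = (\<integral>v. (f r / a r * w powr \<kappa>) * indicator {w..<1} v
        \<partial>lborel)"
      using w by simp
    also have "\<dots> \<le> (\<integral>v. indicator {..<1} v * g r v - indicator {..<w} v * g r v \<partial>lborel)"
    proof (rule integral_mono)
      fix v :: real
      show "(f r / a r * w powr \<kappa>) * indicator {w..<1} v \<le> indicator {..<1} v * g r v
          - indicator {..<w} v * g r v"
      proof (cases "w \<le> v \<and> v < 1")
        case True
        have "f r / a r * w powr \<kappa> \<le> f r / a r * v powr \<kappa>"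
          using True w \<kappa> f_nonneg[OF r(1)] by (intro mult_left_mono powr_mono2) auto
        also have "\<dots> \<le> g r v" using True r r0 by (intro g_ge) auto
        finally show ?thesis using True by simp
      next
        case False
        then show ?thesis using w by (auto simp: indicator_def)
      qed
    next
      show "integrable lborel (\<lambda>v. (f r / a r * w powr \<kappa>) * indicator {w..<1} v)"
        using w by (intro integrable_mult_right integrable_real_indicator) auto
    qed (use ind_int in auto)
    also have "\<dots> = J 1 r - J w r"
      unfolding J_def using ind_int by simp
    finally have "f r / a r \<le> (J 1 r - J w r) / (w powr \<kappa> * (1 - w))"
      using w by (simp add: le_divide_eq)
    also have "\<dots> = Q w r"
      unfolding Q_def by (metis minus_diff_eq minus_divide_divide mult_minus_right)
    finally show ?thesis .
  qed
  have \<phi>_lim: "(\<phi> \<longlongrightarrow> 1) (at 1)"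
  proof -
    have "((\<lambda>w. (1 / \<beta>) * w powr \<beta>) has_real_derivative (1 / \<beta>) * (\<beta> * 1 powr (\<beta> - 1))) (at 1)"
      by (intro DERIV_cmult has_real_derivative_powr) simp
    then have "((\<lambda>w. ((1 / \<beta>) * w powr \<beta> - (1 / \<beta>) * 1 powr \<beta>) / (w - 1)) \<longlongrightarrow> 1) (at 1)"
      using \<beta> by (simp add: has_field_derivative_iff)
    moreover have "((\<lambda>w. w powr \<kappa>) \<longlongrightarrow> 1 powr \<kappa>) (at (1::real))"
      by (intro tendsto_intros) auto
    ultimately have "((\<lambda>w. ((1 / \<beta>) * w powr \<beta> - (1 / \<beta>) * 1 powr \<beta>) / (w - 1) / w powr \<kappa>)
        \<longlongrightarrow> 1 / 1 powr \<kappa>) (at 1)"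
      by (rule tendsto_divide) simp
    moreover have "\<phi> = (\<lambda>w. ((1 / \<beta>) * w powr \<beta> - (1 / \<beta>) * 1 powr \<beta>) / (w - 1) / w powr \<kappa>)"
      by (auto simp: \<phi>_def field_simps)
    ultimately show ?thesis by simp
  qed
  show ?thesis
  proof (rule order_tendstoI)
    fix y :: real assume y: "y < 1"
    have "(\<phi> \<longlongrightarrow> 1) (at_right 1)" using \<phi>_lim by (rule filterlim_mono) (auto simp: at_le)
    from order_tendstoD(1)[OF this y]
    have "\<forall>\<^sub>F w in at_right 1. y < \<phi> w \<and> 1 < w"
      by (intro eventually_conj eventually_at_right_less)
    from eventually_happens'[OF trivial_limit_at_right_real this]
    obtain w where w: "y < \<phi> w" "1 < w" by auto
    have "\<forall>\<^sub>F r in at_top. y < Q w r"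
      using order_tendstoD(1)[OF Q_lim w(1)] w by simp
    then show "\<forall>\<^sub>F r in at_top. y < f r / a r"
      using eventually_gt_at_top[of N]
      by eventually_elim (use Q_right[OF w(2)] in \<open>auto intro: less_le_trans\<close>)
  next
    fix y :: real assume y: "1 < y"
    have "(\<phi> \<longlongrightarrow> 1) (at_left 1)" using \<phi>_lim by (rule filterlim_mono) (auto simp: at_le)
    from order_tendstoD(2)[OF this y]
    have "\<forall>\<^sub>F w in at_left 1. \<phi> w < y \<and> w \<in> {0<..<1}"
      by (intro eventually_conj eventually_at_left_real) auto
    from eventually_happens'[OF trivial_limit_at_left_real this]
    obtain w where w: "\<phi> w < y" "0 < w" "w < 1" by auto
    have "((\<lambda>r. (N / r)\<^sup>2) \<longlongrightarrow> 0\<^sup>2) at_top"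
      by (intro tendsto_power tendsto_divide_0[OF tendsto_const] filterlim_at_top_imp_at_infinity
          filterlim_ident)
    then have "\<forall>\<^sub>F r in at_top. (N / r)\<^sup>2 < w"
      using order_tendstoD(2)[of "\<lambda>r. (N / r)\<^sup>2" 0 at_top w] w by simp
    moreover have "\<forall>\<^sub>F r in at_top. Q w r < y"
      using order_tendstoD(2)[OF Q_lim w(1)] w by simp
    ultimately show "\<forall>\<^sub>F r in at_top. f r / a r < y"
      using eventually_gt_at_top[of N]
      by eventually_elim (use Q_left[OF w(2,3)] in \<open>auto intro: le_less_trans\<close>)
  qed
qed

section \<open>Covariance and spectral measure\<close>

text \<open>The Gaussian duality in the radial variable: the Laplace transform of \<open>b\<close> against
  \<open>v powr (n / 2 - 1)\<close> is, up to an explicit factor, that of the law of the squared norm under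
  \<open>F\<close>.\<close>

lemma spectral_radial_duality:
  fixes F :: "'a::euclidean_space measure" and b :: "real \<Rightarrow> real"
  assumes F: "finite_measure F" "sets F = sets borel"
    and b: "\<And>x::'a. b (norm x) = (\<integral>u. cos (x \<bullet> u) \<partial>F)"
    and [measurable]: "b \<in> borel_measurable borel" and s: "s > 0" and r: "r > 0"
  defines "n \<equiv> real DIM('a)"
  shows "(\<integral>v. indicator {0<..} v * v powr (n / 2 - 1) * exp (- (s * v)) * b (r * v powr (1/2))
      \<partial>lborel)
    = s powr (- (n / 2)) * Gamma (n / 2) * (\<integral>u. exp (- (1 / (4 * s) * (r\<^sup>2 * (norm u)\<^sup>2))) \<partial>F)"
proof -
  let ?I = "\<integral>v. indicator {0<..} v * v powr (n / 2 - 1) * exp (- (s * v)) * b (r * v powr (1/2))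
      \<partial>lborel"
  let ?J = "\<integral>u. exp (- (1 / (4 * s) * (r\<^sup>2 * (norm u)\<^sup>2))) \<partial>F"
  have n: "n > 0" by (simp add: n_def)
  have pt: "exp (- (s * (norm x)\<^sup>2)) * b (r * ((norm x)\<^sup>2) powr (1/2))
      = exp (- (s * (norm x)\<^sup>2)) * (\<integral>u. cos (x \<bullet> (r *\<^sub>R u)) \<partial>F)" for x :: 'a
    using b[of "r *\<^sub>R x"] r by (simp add: powr_half_sqrt)
  have "unit_ball_vol n * (n / 2) * ?I
      = (\<integral>x. exp (- (s * (norm (x::'a))\<^sup>2)) * b (r * ((norm x)\<^sup>2) powr (1/2)) \<partial>lborel)"
    unfolding n_def
    by (subst integral_radial) (auto simp: mult.assoc)
  also have "\<dots> = (pi / s) powr (n / 2) * (\<integral>u. exp (- ((norm (r *\<^sub>R u))\<^sup>2 / (4 * s))) \<partial>F)"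
    unfolding pt n_def by (rule gaussian_duality[OF F s])
  also have "(\<integral>u. exp (- ((norm (r *\<^sub>R u))\<^sup>2 / (4 * s))) \<partial>F) = ?J"
    by (simp add: power_mult_distrib)
  also have "unit_ball_vol n * (n / 2) = pi powr (n / 2) / Gamma (n / 2)"
  proof -
    have "Gamma (n / 2 + 1) = n / 2 * Gamma (n / 2)"
      using n Gamma_plus1[of "n / 2"] by (metis half_gt_zero nonpos_Ints_nonpos not_le)
    then show ?thesis using n by (simp add: unit_ball_vol_def)
  qed
  also have "(pi / s) powr (n / 2) = pi powr (n / 2) * s powr (- (n / 2))"
    using s by (simp add: powr_divide powr_minus_divide)
  finally have eq: "pi powr (n / 2) / Gamma (n / 2) * ?I = pi powr (n / 2) * s powr (- (n / 2))
      * ?J" .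
  have cancel: "i = y * g * j" if "x / g * i = x * y * j" "x \<noteq> 0" "g \<noteq> 0" for x g i y j :: real
    using that by (simp add: field_simps)
  have "Gamma (n / 2) > 0" using n by (intro Gamma_real_pos) simp
  then show ?thesis by (intro cancel[OF eq]) auto
qed

text \<open>The limit hypothesis is stated for \<open>r \<rightarrow> \<infinity>\<close> and the ball of radius \<open>1 / r\<close>, so that the
  behaviour of \<open>F\<close> near the origin and of the covariance at infinity are compared with the same
  function \<open>a\<close>. The mass of that ball decreases in \<open>r\<close>, as the uniform bounds require.\<close>

lemma spectral_abelian:
  fixes F :: "'a::euclidean_space measure" and a :: "real \<Rightarrow> real"
  assumes F: "finite_measure F" and sets [measurable_cong]: "sets F = sets borel"
    and a: "regularly_varying (- \<alpha>) a" and \<alpha>: "\<alpha> \<ge> 0" and c: "c > 0"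
    and lim: "((\<lambda>r. measure F {u. norm u < 1 / r} / a r) \<longlongrightarrow> c) at_top" and s: "s > 0"
  shows "((\<lambda>r. (\<integral>u. exp (- (s * (r\<^sup>2 * (norm u)\<^sup>2))) \<partial>F) / a r)
     \<longlongrightarrow> c * (Gamma (\<alpha> / 2 + 1) * s powr (- (\<alpha> / 2)))) at_top"
proof -
  interpret F: finite_measure F by fact
  have sp [simp]: "space F = UNIV" using sets_eq_imp_space_eq[OF sets] by simp
  define G where "G l = measure F {u. norm u < l}" for l
  have G_mono: "mono G"
    unfolding G_def by (intro monoI F.finite_measure_mono) auto
  have [measurable]: "G \<in> borel_measurable borel" by (rule borel_measurable_mono) fact
  have "((\<lambda>r. (\<integral>v. indicator {0<..} v * v powr (1 - 1) * exp (- (s * v))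
      * G (1 / (r * v powr (- 1/2))) \<partial>lborel) / a r)
     \<longlongrightarrow> c * (Gamma (1 - (- 1/2) * \<alpha>) * s powr (- (1 - (- 1/2) * \<alpha>)))) at_top"
  proof (rule laplace_abelian[OF a _ c, where N = 0 and p = 0 and q = "\<alpha> + 1" and K
      = "measure F UNIV"])
    show "((\<lambda>x. G (1 / x) / a x) \<longlongrightarrow> c) at_top" using lim by (simp add: G_def)
    show "y powr 0 * G (1 / y) \<le> x powr 0 * G (1 / x)" if "0 < x" "x \<le> y" for x y
      using that monoD[OF G_mono, of "1 / y" "1 / x"] by (simp add: frac_le)
    show "\<bar>G (1 / x)\<bar> \<le> measure F UNIV" for x
      unfolding G_def using F.bounded_measure by simp
 qed (use \<alpha> s in \<open>auto intro: add_pos_nonneg\<close>)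
  then have "((\<lambda>r. s * ((\<integral>v. indicator {0<..} v * v powr (1 - 1) * exp (- (s * v))
      * G (1 / (r * v powr (- 1/2))) \<partial>lborel) / a r))
     \<longlongrightarrow> s * (c * (Gamma (1 - (- 1/2) * \<alpha>) * s powr (- (1 - (- 1/2) * \<alpha>))))) at_top"
    by (rule tendsto_mult_left)
  also have "s * (c * (Gamma (1 - (- 1/2) * \<alpha>) * s powr (- (1 - (- 1/2) * \<alpha>))))
      = c * (Gamma (\<alpha> / 2 + 1) * s powr (- (\<alpha> / 2)))"
  proof -
    have "s powr (- (1 - (- 1/2) * \<alpha>)) = s powr (- (\<alpha> / 2)) * s powr (-1)"
      by (simp only: powr_add[symmetric]) (simp add: algebra_simps)
    also have "s powr (-1) = 1 / s" using s by (simp add: powr_minus_divide)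
    finally show ?thesis using s by (simp add: add.commute)
  qed
  finally show ?thesis
  proof (rule Lim_transform_eventually)
    show "\<forall>\<^sub>F r in at_top. s * ((\<integral>v. indicator {0<..} v * v powr (1 - 1) * exp (- (s * v))
        * G (1 / (r * v powr (- 1/2))) \<partial>lborel) / a r)
       = (\<integral>u. exp (- (s * (r\<^sup>2 * (norm u)\<^sup>2))) \<partial>F) / a r"
      using eventually_gt_at_top[of 0]
    proof eventually_elim
      case (elim r)
      have "(\<integral>u. exp (- (s * (r\<^sup>2 * (norm u)\<^sup>2))) \<partial>F)
        = s * (\<integral>v. indicator {0<..} v * exp (- (s * v)) * measure F {u \<in> space F. r\<^sup>2
            * (norm u)\<^sup>2 < v} \<partial>lborel)"
        by (rule integral_exp_layer_cake[OF F _ _ s]) auto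
      also have "(\<integral>v. indicator {0<..} v * exp (- (s * v)) * measure F {u \<in> space F. r\<^sup>2
          * (norm u)\<^sup>2 < v} \<partial>lborel)
        = (\<integral>v. indicator {0<..} v * v powr (1 - 1) * exp (- (s * v))
            * G (1 / (r * v powr (- 1/2))) \<partial>lborel)"
      proof (rule Bochner_Integration.integral_cong[OF refl])
        fix v :: real
        show "indicator {0<..} v * exp (- (s * v)) * measure F {u \<in> space F. r\<^sup>2 * (norm u)\<^sup>2 < v}
          = indicator {0<..} v * v powr (1 - 1) * exp (- (s * v)) * G (1 / (r * v powr (- 1/2)))"
        proof (cases "v > 0")
          case True
          have "norm u < 1 / (r * v powr (- 1/2)) \<longleftrightarrow> r\<^sup>2 * (norm u)\<^sup>2 < v" for u :: 'a
          proof -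
            have "norm u < 1 / (r * v powr (- 1/2)) \<longleftrightarrow> r * norm u < sqrt v"
              using True elim by (simp add: powr_minus powr_half_sqrt field_simps)
            also have "\<dots> \<longleftrightarrow> sqrt ((r * norm u)\<^sup>2) < sqrt v" using elim by simp
            also have "\<dots> \<longleftrightarrow> r\<^sup>2 * (norm u)\<^sup>2 < v"
                by (simp only: real_sqrt_less_iff power_mult_distrib)
            finally show ?thesis .
          qed
          then show ?thesis using True by (simp add: G_def)
        qed simp
      qed
      finally show ?case by simp
    qed
  qed
qed

lemma spectral_tauberian:
  fixes F :: "'a::euclidean_space measure" and a :: "real \<Rightarrow> real"
  assumes F: "finite_measure F" and sets [measurable_cong]: "sets F = sets borel"
    and apos: "\<And>x. x > 0 \<Longrightarrow> a x > 0" and \<alpha>: "\<alpha> \<ge> 0" and c: "c \<ge> 0"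
    and lim: "\<And>s. s > 0 \<Longrightarrow> ((\<lambda>r. (\<integral>u. exp (- (s * (r\<^sup>2 * (norm u)\<^sup>2))) \<partial>F) / a r)
     \<longlongrightarrow> c * (Gamma (\<alpha> / 2 + 1) * s powr (- (\<alpha> / 2)))) at_top"
  shows "((\<lambda>r. measure F {u. norm u < 1 / r} / a r) \<longlongrightarrow> c) at_top"
proof -
  interpret F: finite_measure F by fact
  have sp [simp]: "space F = UNIV" using sets_eq_imp_space_eq[OF sets] by simp
  let ?g = "\<lambda>r (u::'a). if r > 0 then 1 / a r else 0"
  have "((\<lambda>r. \<integral>u. indicator {..<1} (r\<^sup>2 * (norm u)\<^sup>2) * ?g r u \<partial>F) \<longlongrightarrow> c * 1 powr (\<alpha> / 2)) at_top"
  proof (rule karamata_tauberian)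
    show "AE u in F. 0 \<le> ?g r u" for r using apos[of r] by (cases "r > 0") auto
    show "integrable F (\<lambda>u. exp (- (r\<^sup>2 * (norm u)\<^sup>2)) * ?g r u)" for r
      by (rule F.integrable_const_bound[where B = "\<bar>1 / a r\<bar>"])
          (auto simp: abs_mult divide_right_mono)
    show "((\<lambda>r. \<integral>u. exp (- (s * (r\<^sup>2 * (norm u)\<^sup>2))) * ?g r u \<partial>F)
       \<longlongrightarrow> c * (Gamma (\<alpha> / 2 + 1) * s powr (- (\<alpha> / 2)))) at_top" if "s > 0" for s
      using lim[OF that]
      by (rule Lim_transform_eventually)
         (auto intro: eventually_mono[OF eventually_gt_at_top[of 0]])
  qed (use \<alpha> c in auto)
  then have "((\<lambda>r. \<integral>u. indicator {..<1} (r\<^sup>2 * (norm u)\<^sup>2) * ?g r u \<partial>F) \<longlongrightarrow> c) at_top" by simp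
  then show ?thesis
  proof (rule Lim_transform_eventually)
    show "\<forall>\<^sub>F r in at_top. (\<integral>u. indicator {..<1} (r\<^sup>2 * (norm u)\<^sup>2) * ?g r u \<partial>F)
        = measure F {u. norm u < 1 / r} / a r"
      using eventually_gt_at_top[of 0]
    proof eventually_elim
      case (elim r)
      have "r\<^sup>2 * (norm u)\<^sup>2 < 1 \<longleftrightarrow> norm u < 1 / r" for u :: 'a
      proof -
        have "r\<^sup>2 * (norm u)\<^sup>2 < 1 \<longleftrightarrow> \<bar>r * norm u\<bar> < 1"
          by (simp only: abs_square_less_1[symmetric] power_mult_distrib)
        also have "\<dots> \<longleftrightarrow> norm u < 1 / r" using elim by (simp add: abs_mult field_simps)
        finally show ?thesis .
      qed
      then have "(\<integral>u. indicator {..<1} (r\<^sup>2 * (norm u)\<^sup>2) * ?g r u \<partial>F)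
         = (\<integral>u. indicator {u. norm u < 1 / r} u * (1 / a r) \<partial>F)"
        using elim by (intro Bochner_Integration.integral_cong) (auto simp: indicator_def)
      then show ?case by simp
    qed
  qed
qed

text \<open>The condition under which the part of the covariance near \<open>0\<close> is negligible in the
  Tauberian theorem: \<open>a r\<close> is bounded below by a multiple of \<open>r powr (- q)\<close> for some \<open>q < n\<close>,
  because the spectral mass is.\<close>

lemma powr_negligible_of_spectral_limit:
  fixes F :: "'a::euclidean_space measure" and a :: "real \<Rightarrow> real"
  assumes F: "finite_measure F" and sets [measurable_cong]: "sets F = sets borel"
    and a: "regularly_varying (- \<alpha>) a" and \<alpha>: "\<alpha> \<ge> 0" "\<alpha> < n" and c: "c > 0"
    and lim: "((\<lambda>r. measure F {u. norm u < 1 / r} / a r) \<longlongrightarrow> c) at_top"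
  shows "((\<lambda>r. r powr (- n) / a r) \<longlongrightarrow> 0) at_top"
proof -
  interpret F: finite_measure F by fact
  have sp [simp]: "space F = UNIV" using sets_eq_imp_space_eq[OF sets] by simp
  define g where "g r = measure F {u. norm u < 1 / r}" for r
  define q where "q = (\<alpha> + n) / 2"
  have q: "\<alpha> < q" "q < n" "0 \<le> q" using \<alpha> by (auto simp: q_def)
  have anti: "y powr 0 * g y \<le> x powr 0 * g x" if "0 < x" "x \<le> y" for x y
  proof -
    have "1 / y \<le> 1 / x" using that by (simp add: frac_le)
    then have "g y \<le> g x"
      unfolding g_def by (intro F.finite_measure_mono) auto
    then show ?thesis using that by simp
  qed
  have K: "\<bar>g x\<bar> \<le> measure F UNIV" for x
    unfolding g_def using F.bounded_measure by simp
  obtain R C where R: "R > 0" "C > 0" "\<And>r. r \<ge> R \<Longrightarrow> g r > 0"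
    "\<And>r x. r \<ge> R \<Longrightarrow> x > 0 \<Longrightarrow> \<bar>g (r * x)\<bar> / a r \<le> C * (x powr (- q) + x powr (- 0))"
    using regularly_varying_bound[OF a _ c anti K q(1,3) q(3)] lim unfolding g_def[symmetric]
        by metis
  have apos: "a x > 0" if "x > 0" for x using a that by (simp add: regularly_varying_def)
  define D where "D = C * 2 * R powr (- q) / g R"
  have gR: "g R > 0" by (rule R) simp
  have bound: "norm (r powr (- n) / a r) \<le> D * r powr (- (n - q))" if r: "r \<ge> R" for r
  proof -
    have r0: "r > 0" using r R by simp
    have "g R / a r \<le> C * ((R / r) powr (- q) + (R / r) powr (- 0))"
      using R(4)[OF r, of "R / r"] r0 R(1) gR by simp
    also have "\<dots> \<le> C * ((r / R) powr q + (r / R) powr q)"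
    proof -
      have "1 \<le> (r / R) powr q" using q r R(1) by (intro ge_one_powr_ge_zero) auto
      moreover have "(R / r) powr (- q) = (r / R) powr q"
        using r0 R(1) by (simp add: powr_divide powr_minus field_simps)
      ultimately show ?thesis using R(2) r0 R(1) by (intro mult_left_mono add_mono) auto
    qed
    also have "\<dots> = C * 2 * R powr (- q) * r powr q"
      using r0 R(1) by (simp add: powr_divide powr_minus field_simps)
    finally have "1 / a r \<le> D * r powr q"
      using gR apos[OF r0] by (simp add: D_def field_simps)
    then have "r powr (- n) * (1 / a r) \<le> r powr (- n) * (D * r powr q)"
      by (intro mult_left_mono) auto
    also have "\<dots> = D * r powr (- (n - q))"
      by (simp add: powr_add[symmetric])
    finally show ?thesis using apos[OF r0] by simp
  qed
  show ?thesis
  proof (rule Lim_null_comparison)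
    show "\<forall>\<^sub>F r in at_top. norm (r powr (- n) / a r) \<le> D * r powr (- (n - q))"
      using eventually_ge_at_top[of R] by eventually_elim (rule bound)
    have "((\<lambda>r. r powr (- (n - q))) \<longlongrightarrow> 0) at_top"
      using q by (intro tendsto_neg_powr filterlim_ident) auto
    from tendsto_mult_left[OF this, of D]
    show "((\<lambda>r. D * r powr (- (n - q))) \<longlongrightarrow> 0) at_top" by simp
  qed
qed

text \<open>The equivalence for nonnegative indices. Both conditions are equivalent to convergence of
  Laplace transforms, \<open>I\<close> for the covariance and \<open>J\<close> for the spectral measure, and the duality
  translates \<open>I\<close> into \<open>J\<close>; the constants match because \<open>J\<close> is evaluated at \<open>1 / (4 * s)\<close>.\<close>

theorem covariance_spectral_equivalence:
  fixes F :: "'a::euclidean_space measure" and b a :: "real \<Rightarrow> real"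
  defines "n \<equiv> real DIM('a)"
  assumes F: "finite_measure F" "sets F = sets borel"
    and b: "\<And>x::'a. b (norm x) = (\<integral>u. cos (x \<bullet> u) \<partial>F)"
    and b_meas: "b \<in> borel_measurable borel"
    and N: "N > 0"
    and anti: "\<And>x y. N < x \<Longrightarrow> x \<le> y \<Longrightarrow> y powr p * b y \<le> x powr p * b x"
    and nonneg: "\<And>x. N < x \<Longrightarrow> b x \<ge> 0"
    and K: "\<And>x. x > 0 \<Longrightarrow> \<bar>b x\<bar> \<le> K"
    and a: "regularly_varying (- \<alpha>) a"
    and \<alpha>: "0 \<le> \<alpha>" "\<alpha> < n" and p: "p < \<alpha>" "p \<le> n - 2"
  shows "((\<lambda>r. b r / a r) \<longlongrightarrow> 1) at_top \<longleftrightarrow>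
    ((\<lambda>r. measure F {u. norm u < 1 / r} / a r) \<longlongrightarrow>
      Gamma ((n - \<alpha>) / 2) / (2 powr \<alpha> * Gamma (\<alpha> / 2 + 1) * Gamma (n / 2))) at_top"
proof -
  define c where "c = Gamma ((n - \<alpha>) / 2) / (2 powr \<alpha> * Gamma (\<alpha> / 2 + 1) * Gamma (n / 2))"
  have n: "n > 0" by (simp add: n_def)
  have gpos: "Gamma ((n - \<alpha>) / 2) > 0" "Gamma (\<alpha> / 2 + 1) > 0" "Gamma (n / 2) > 0"
    using \<alpha> n by auto
  have c: "c > 0" using gpos by (simp add: c_def)
  have apos: "a x > 0" if "x > 0" for x using a that by (simp add: regularly_varying_def)
  define I where "I s r = (\<integral>v. indicator {0<..} v * v powr (n / 2 - 1) * exp (- (s * v))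
      * b (r * v powr (1/2)) \<partial>lborel) / a r" for s r
  define J where "J s r = (\<integral>u. exp (- (s * (r\<^sup>2 * (norm u)\<^sup>2))) \<partial>F) / a r" for s r
  have duality: "\<forall>\<^sub>F r in at_top. I s r = s powr (- (n / 2)) * Gamma (n / 2) * J (1 / (4 * s)) r"
      if "s > 0" for s
    using eventually_gt_at_top[of 0]
  proof eventually_elim
    case (elim r)
    show ?case
      unfolding I_def J_def n_def spectral_radial_duality[OF F b b_meas that elim] by simp
  qed
  have const: "s powr (- (n / 2)) * Gamma (n / 2)
      * (c * (Gamma (\<alpha> / 2 + 1) * (1 / (4 * s)) powr (- (\<alpha> / 2))))
      = Gamma (n / 2 - 1/2 * \<alpha>) * s powr (- (n / 2 - 1/2 * \<alpha>))" if s: "s > 0" for s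
  proof -
    have "(1 / (4 * s)) powr (- (\<alpha> / 2)) = (4 * s) powr (\<alpha> / 2)"
      using s by (simp add: powr_divide powr_minus field_simps)
    also have "\<dots> = (2 powr 2) powr (\<alpha> / 2) * s powr (\<alpha> / 2)"
      using s by (simp add: powr_mult)
    also have "\<dots> = 2 powr \<alpha> * s powr (\<alpha> / 2)"
      by (simp only: powr_powr) simp
    finally have e: "(1 / (4 * s)) powr (- (\<alpha> / 2)) = 2 powr \<alpha> * s powr (\<alpha> / 2)" .
    have "s powr (- (n / 2 - 1/2 * \<alpha>)) = s powr (- (n / 2)) * s powr (\<alpha> / 2)"
      by (simp add: powr_add[symmetric])
    moreover have "n / 2 - 1/2 * \<alpha> = (n - \<alpha>) / 2" by (simp add: field_simps)
    ultimately show ?thesis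
      unfolding e c_def using gpos by (simp add: field_simps)
  qed
  have IJ: "(\<forall>s>0. (I s \<longlongrightarrow> Gamma (n / 2 - 1/2 * \<alpha>) * s powr (- (n / 2 - 1/2 * \<alpha>))) at_top) \<longleftrightarrow>
       (\<forall>s>0. (J s \<longlongrightarrow> c * (Gamma (\<alpha> / 2 + 1) * s powr (- (\<alpha> / 2)))) at_top)"
  proof (intro iffI allI impI)
    fix s :: real assume s: "s > 0"
      and *: "\<forall>s>0. (J s \<longlongrightarrow> c * (Gamma (\<alpha> / 2 + 1) * s powr (- (\<alpha> / 2)))) at_top"
    have "(J (1 / (4 * s)) \<longlongrightarrow> c * (Gamma (\<alpha> / 2 + 1) * (1 / (4 * s)) powr (- (\<alpha> / 2)))) at_top"
      using * s by simp
    from tendsto_mult_left[OF this, of "s powr (- (n / 2)) * Gamma (n / 2)"]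
    show "(I s \<longlongrightarrow> Gamma (n / 2 - 1/2 * \<alpha>) * s powr (- (n / 2 - 1/2 * \<alpha>))) at_top"
      unfolding const[OF s]
      by (rule Lim_transform_eventually) (use duality[OF s] in \<open>auto elim: eventually_mono\<close>)
  next
    fix t :: real assume t: "t > 0"
      and *: "\<forall>s>0. (I s \<longlongrightarrow> Gamma (n / 2 - 1/2 * \<alpha>) * s powr (- (n / 2 - 1/2 * \<alpha>))) at_top"
    define s where "s = 1 / (4 * t)"
    have s: "s > 0" and st: "1 / (4 * s) = t" using t by (auto simp: s_def)
    define k where "k = s powr (- (n / 2)) * Gamma (n / 2)"
    have k: "k > 0" using s gpos by (simp add: k_def)
    have "(I s \<longlongrightarrow> k * (c * (Gamma (\<alpha> / 2 + 1) * t powr (- (\<alpha> / 2))))) at_top"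
      using * s const[OF s] unfolding st k_def by simp
    from tendsto_mult_left[OF this, of "1 / k"]
    have "((\<lambda>r. 1 / k * I s r) \<longlongrightarrow> c * (Gamma (\<alpha> / 2 + 1) * t powr (- (\<alpha> / 2)))) at_top"
      using k by simp
    then show "(J t \<longlongrightarrow> c * (Gamma (\<alpha> / 2 + 1) * t powr (- (\<alpha> / 2)))) at_top"
    proof (rule Lim_transform_eventually)
      show "\<forall>\<^sub>F r in at_top. 1 / k * I s r = J t r"
        using duality[OF s] unfolding st k_def[symmetric] by eventually_elim (use k in simp)
    qed
  qed
  show ?thesis
    unfolding c_def[symmetric]
  proof
    assume lim: "((\<lambda>r. b r / a r) \<longlongrightarrow> 1) at_top"
    have "(I s \<longlongrightarrow> 1 * (Gamma (n / 2 - 1/2 * \<alpha>) * s powr (- (n / 2 - 1/2 * \<alpha>)))) at_top"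
        if s: "s > 0" for s
      unfolding I_def
      by (rule laplace_abelian[OF a lim zero_less_one anti K, where q = "(\<alpha> + n) / 2"])
         (use \<alpha> p s b_meas in auto)
    then have "\<forall>s>0. (J s \<longlongrightarrow> c * (Gamma (\<alpha> / 2 + 1) * s powr (- (\<alpha> / 2)))) at_top"
      using IJ by simp
    then show "((\<lambda>r. measure F {u. norm u < 1 / r} / a r) \<longlongrightarrow> c) at_top"
      unfolding J_def using apos \<alpha> c by (intro spectral_tauberian[OF F]) auto
  next
    assume lim: "((\<lambda>r. measure F {u. norm u < 1 / r} / a r) \<longlongrightarrow> c) at_top"
    have "\<forall>s>0. (J s \<longlongrightarrow> c * (Gamma (\<alpha> / 2 + 1) * s powr (- (\<alpha> / 2)))) at_top"
      unfolding J_def using spectral_abelian[OF F a \<alpha>(1) c lim] by blast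
    then have I: "\<forall>s>0. (I s \<longlongrightarrow> Gamma (n / 2 - 1/2 * \<alpha>) * s powr (- (n / 2 - 1/2 * \<alpha>))) at_top"
      using IJ by simp
    show "((\<lambda>r. b r / a r) \<longlongrightarrow> 1) at_top"
    proof (rule laplace_tauberian_monotone[OF b_meas K N anti nonneg apos, where m = "n / 2" and \<beta>
        = "n / 2 - 1/2 * \<alpha>"])
      show "((\<lambda>r. r powr (- (2 * (n / 2))) / a r) \<longlongrightarrow> 0) at_top"
        using powr_negligible_of_spectral_limit[OF F a \<alpha> c lim] by simp
      show "((\<lambda>r. (\<integral>v. indicator {0<..} v * v powr (n / 2 - 1) * exp (- (s * v))
          * b (r * v powr (1/2)) \<partial>lborel) / a r)
          \<longlongrightarrow> Gamma (n / 2 - 1/2 * \<alpha>) * s powr (- (n / 2 - 1/2 * \<alpha>))) at_top" if "s > 0" for s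
        using I that unfolding I_def by blast
    qed (use \<alpha> p n in auto)
  qed
qed

section \<open>The equivalence of the two asymptotic relations\<close>

theorem theorem2:
  fixes M :: "'w measure"
    and \<xi> :: "real^'n \<Rightarrow> 'w \<Rightarrow> real"
    and B L G :: "real \<Rightarrow> real"
    and F :: "(real^'n) measure"
    and \<alpha> :: real
  defines "G \<equiv> spectral_distribution_function F"
  assumes "homogeneous_isotropic_field M \<xi> B"
    and "mean_square_continuous M \<xi>"
    and "\<And>x. (\<integral>w. \<xi> x w \<partial>M) = 0"
    and "\<And>x. prob_space.variance M (\<xi> x) = 1"
    and "is_spectral_measure B F"
    and "L \<in> class_L"
    and "ultimately_decreasing_to_zero (\<lambda>r. r powr ((real CARD('n) - 3) / 2) * B r)"
    and "(real CARD('n) - 3) / 2 < \<alpha>" and "\<alpha> < real CARD('n)"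
  shows "((\<lambda>r. r powr \<alpha> * B r) \<sim>[at_top] L) \<longleftrightarrow>
         ((\<lambda>l. G l / l powr \<alpha>) \<sim>[at_right 0] (\<lambda>l. L (1 / l) / c1 CARD('n) \<alpha>))"
proof -
  define n where "n = real CARD('n)"
  define p where "p = (n - 3) / 2"
  have DIM: "real DIM(real^'n) = n" by (simp add: n_def)
  have n1: "n \<ge> 1" by (simp add: n_def Suc_le_eq)
  have \<alpha>: "p < \<alpha>" "\<alpha> < n" using assms(9,10) by (auto simp: n_def p_def)
  have sets [measurable_cong]: "sets F = sets borel" and fin: "finite_measure F"
    and spec: "\<And>x. complex_of_real (B (norm x)) = (\<integral>u. iexp (x \<bullet> u) \<partial>F)"
    using assms(6) by (auto simp: is_spectral_measure_def)
  interpret F: finite_measure F by (rule fin)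
  have sp [simp]: "space F = UNIV" using sets_eq_imp_space_eq[OF sets] by simp
  have L_pos: "\<And>x. x > 0 \<Longrightarrow> L x > 0"
    and L_lim: "\<And>t. t > 0 \<Longrightarrow> ((\<lambda>x. L (x * t) / L x) \<longlongrightarrow> 1) at_top"
    using assms(7) by (auto simp: class_L_def slowly_varying_def)

  \<comment> \<open>\<open>B\<close> is arbitrary on negative arguments; its even extension \<open>b\<close> is measurable.\<close>
  define b where "b x = B \<bar>x\<bar>" for x
  have b_cos: "b (norm x) = (\<integral>u. cos (x \<bullet> u) \<partial>F)" for x :: "real^'n"
  proof -
    have int: "integrable F (\<lambda>u. iexp (x \<bullet> u))"
      by (rule F.integrable_const_bound[where B = 1]) auto
    have "B (norm x) = Re (\<integral>u. iexp (x \<bullet> u) \<partial>F)" by (simp flip: spec)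
    also have "\<dots> = (\<integral>u. Re (iexp (x \<bullet> u)) \<partial>F)" by (rule integral_Re[OF int, symmetric])
    also have "\<dots> = (\<integral>u. cos (x \<bullet> u) \<partial>F)" by (simp add: Re_exp)
    finally show ?thesis by (simp add: b_def)
  qed
  have b_line: "b t = (\<integral>u. cos ((t *\<^sub>R axis undefined 1) \<bullet> u) \<partial>F)" for t
    using b_cos[of "t *\<^sub>R axis undefined 1"] by (simp add: b_def)
  have b_meas: "b \<in> borel_measurable borel"
    unfolding b_line[abs_def] by measurable
  have b_bound: "\<bar>b t\<bar> \<le> measure F UNIV" for t
  proof -
    have "\<bar>b t\<bar> \<le> (\<integral>u. \<bar>cos ((t *\<^sub>R axis undefined 1) \<bullet> u)\<bar> \<partial>F)"
      unfolding b_line by (rule integral_abs_bound)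
    also have "\<dots> \<le> (\<integral>u. 1 \<partial>F)"
      by (intro integral_mono F.integrable_const_bound[where B = 1]) auto
    finally show ?thesis by simp
  qed
  from assms(8) obtain N0 where lim0: "((\<lambda>r. r powr p * B r) \<longlongrightarrow> 0) at_top"
    and anti0: "antimono_on {N0<..} (\<lambda>r. r powr p * B r)"
    by (auto simp: ultimately_decreasing_to_zero_def p_def n_def)
  define N where "N = max N0 1"
  have N: "N > 0" by (simp add: N_def)
  have b_anti: "y powr p * b y \<le> x powr p * b x" if "N < x" "x \<le> y" for x y
    using monotone_onD[OF anti0, of x y] that by (simp add: N_def b_def)
  have b_nonneg: "b x \<ge> 0" if x: "N < x" for x
  proof -
    have "0 \<le> x powr p * b x"
    proof (rule tendsto_upperbound[OF lim0])
      show "\<forall>\<^sub>F y in at_top. y powr p * B y \<le> x powr p * b x"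
        using eventually_ge_at_top[of x]
        by eventually_elim (use b_anti[OF x] x N in \<open>auto simp: b_def\<close>)
    qed simp
    moreover have "x powr p > 0" using x N by simp
    ultimately show ?thesis by (simp add: zero_le_mult_iff)
  qed

  define a where "a r = r powr (- \<alpha>) * L r" for r
  have a_pos: "a r > 0" if "r > 0" for r using that L_pos by (simp add: a_def)
  have a: "regularly_varying (- \<alpha>) a"
    unfolding regularly_varying_def
  proof (intro conjI allI impI)
    fix t :: real assume t: "t > 0"
    have "((\<lambda>x. t powr (- \<alpha>) * (L (x * t) / L x)) \<longlongrightarrow> t powr (- \<alpha>) * 1) at_top"
      by (intro tendsto_mult_left L_lim t)
    then have "((\<lambda>x. t powr (- \<alpha>) * (L (x * t) / L x)) \<longlongrightarrow> t powr (- \<alpha>)) at_top" by simp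
    then show "((\<lambda>x. a (x * t) / a x) \<longlongrightarrow> t powr (- \<alpha>)) at_top"
    proof (rule Lim_transform_eventually)
      show "\<forall>\<^sub>F x in at_top. t powr (- \<alpha>) * (L (x * t) / L x) = a (x * t) / a x"
        using eventually_gt_at_top[of 0]
        by eventually_elim (use t in \<open>simp add: a_def powr_mult\<close>)
    qed
  qed (rule a_pos)

  define g where "g r = measure F {u. norm u < 1 / r}" for r
  define c where "c = Gamma ((n - \<alpha>) / 2) / (2 powr \<alpha> * Gamma (\<alpha> / 2 + 1) * Gamma (n / 2))"
  have c1: "c1 CARD('n) \<alpha> = 1 / c" by (simp add: c1_def c_def n_def)
  have c: "c > 0"
  proof -
    have "Gamma ((n - \<alpha>) / 2) > 0" "Gamma (\<alpha> / 2 + 1) > 0" "Gamma (n / 2) > 0"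
      using \<alpha> n1 by (auto simp: p_def)
    then show ?thesis by (simp add: c_def)
  qed

  \<comment> \<open>With \<open>a r = r powr (- \<alpha>) * L r\<close> both conditions become limits as \<open>r \<rightarrow> \<infinity>\<close>, the second one
    through \<open>l = 1 / r\<close>.\<close>
  have a_iff: "((\<lambda>r. r powr \<alpha> * B r) \<sim>[at_top] L) \<longleftrightarrow> ((\<lambda>r. b r / a r) \<longlongrightarrow> 1) at_top"
    unfolding asymp_equiv_def
  proof (rule tendsto_cong)
    show "\<forall>\<^sub>F r in at_top. (if r powr \<alpha> * B r = 0 \<and> L r = 0 then 1 else r powr \<alpha> * B r / L r)
        = b r / a r"
      using eventually_gt_at_top[of 0]
    proof eventually_elim
      case (elim r)
      then show ?case using L_pos[OF elim] by (simp add: a_def b_def powr_minus field_simps)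
    qed
  qed
  have g_iff: "((\<lambda>l. G l / l powr \<alpha>) \<sim>[at_right 0] (\<lambda>l. L (1 / l) / c1 CARD('n) \<alpha>))
      \<longleftrightarrow> ((\<lambda>r. g r / a r) \<longlongrightarrow> c) at_top"
  proof -
    have "((\<lambda>l. G l / l powr \<alpha>) \<sim>[at_right 0] (\<lambda>l. L (1 / l) / c1 CARD('n) \<alpha>))
        \<longleftrightarrow> ((\<lambda>r. (g r / a r) / c) \<longlongrightarrow> 1) at_top"
      unfolding asymp_equiv_def filterlim_at_right_to_top
    proof (rule tendsto_cong)
      show "\<forall>\<^sub>F r in at_top. (if G (inverse r) / inverse r powr \<alpha> = 0 \<and> L (1 / inverse r)
          / c1 CARD('n) \<alpha> = 0 then 1
          else G (inverse r) / inverse r powr \<alpha> / (L (1 / inverse r) / c1 CARD('n) \<alpha>))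
              = g r / a r / c"
        using eventually_gt_at_top[of 0]
      proof eventually_elim
        case (elim r)
        have "G (inverse r) = g r"
          by (simp add: assms(1) spectral_distribution_function_def g_def inverse_eq_divide)
        moreover have "inverse r powr \<alpha> = r powr (- \<alpha>)"
          using elim by (simp add: powr_minus inverse_powr)
        moreover have "1 / inverse r = r" by (simp add: inverse_eq_divide)
        ultimately show ?case using L_pos[OF elim] c by (simp add: a_def c1)
      qed
    qed
    also have "\<dots> \<longleftrightarrow> ((\<lambda>r. g r / a r) \<longlongrightarrow> c) at_top"
    proof
      assume "((\<lambda>r. g r / a r / c) \<longlongrightarrow> 1) at_top"
      from tendsto_mult_right[OF this, of c] show "((\<lambda>r. g r / a r) \<longlongrightarrow> c) at_top"
        using c by simp
    next
      assume "((\<lambda>r. g r / a r) \<longlongrightarrow> c) at_top"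
      from tendsto_divide[OF this tendsto_const, of c] show "((\<lambda>r. g r / a r / c) \<longlongrightarrow> 1) at_top"
        using c by simp
    qed
    finally show ?thesis .
  qed

  have "((\<lambda>r. b r / a r) \<longlongrightarrow> 1) at_top \<longleftrightarrow> ((\<lambda>r. g r / a r) \<longlongrightarrow> c) at_top"
  proof (cases "\<alpha> \<ge> 0")
    case True
    show ?thesis
      unfolding g_def c_def DIM[symmetric]
      by (rule covariance_spectral_equivalence[OF fin sets b_cos b_meas N b_anti b_nonneg b_bound
            a True])
         (use \<alpha> n1 in \<open>auto simp: n_def p_def\<close>)
  next
    case False
    \<comment> \<open>For negative \<open>\<alpha>\<close> the function \<open>a\<close> is unbounded while \<open>b\<close> and \<open>g\<close> are bounded, so both sides
      are false.\<close>
    then have "- \<alpha> > 0" by simp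
    have "\<not> ((\<lambda>r. b r / a r) \<longlongrightarrow> 1) at_top"
      using regularly_varying_unbounded[OF a _ zero_less_one \<open>- \<alpha> > 0\<close>, of b
          "measure F UNIV"] b_bound
      by (auto simp: abs_le_iff)
    moreover have "\<not> ((\<lambda>r. g r / a r) \<longlongrightarrow> c) at_top"
      using regularly_varying_unbounded[OF a _ c \<open>- \<alpha> > 0\<close>, of g "measure F UNIV"] F.bounded_measure
      by (auto simp: g_def)
    ultimately show ?thesis by blast
  qed
  then show ?thesis unfolding a_iff g_iff .
qed

end
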